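(* Let $(\Omega,\eta,X,\mu,Y,\nu,i,j)$ be a measure equivalence coupling between unimodular lcsc groups $G$ and $H$, with action $(g,h,t)\mapsto (g,h).t$. Then there are conull Borel subsets $\Omega'\subset\Omega$, $X'\subset X$, $Y'\subset Y$ and a measure preserving Borel action $G\times H\times\Omega'\to\Omega'$, $(g,h,t)\mapsto(g,h)\triangleright t$, such that: (i) for every $(g,h)\in G\times H$, $(g,h).t=(g,h)\triangleright t$ for $\eta$-almost every $t\in\Omega'$; (ii) there is a Borel isomorphism $i':G\times Y'\to\Omega'$ with $i'_*(\lambda_G\times\nu|_{Y'})=\eta|_{\Omega'}$ and $i'(g_0g,y)=(g_0,e_H)\triangleright i'(g,y)$ for all $g_0,g\in G$, $y\in Y'$; (iii) there is a Borel isomorphism $j':H\times X'\to\Omega'$ with $j'_*(\lambda_H\times\mu|_{X'})=\eta|_{\Omega'}$ and $j'(h_0h,x)=(e_G,h_0)\triangleright j'(h,x)$ for all $h_0,h\in H$, $x\in X'$.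
   Context: lcsc = locally compact second countable Hausdorff; $\lambda_G$ is a Haar measure. For unimodular lcsc $G,H$, a measure equivalence coupling is a tuple $(\Omega,\eta,X,\mu,Y,\nu,i,j)$ where $\Omega$ is a standard Borel space with a Borel action of $G\times H$ preserving a nonzero Borel measure $\eta$, $(X,\mu),(Y,\nu)$ are standard Borel spaces with finite Borel measures, $i$ is an isomorphism of measure $G$-spaces from $(G\times Y,\lambda_G\times\nu)$ (with $g.(g',y)=(gg',y)$) to $(\Omega,\eta)$, and $j$ is an isomorphism of measure $H$-spaces from $(H\times X,\lambda_H\times\mu)$ (with $h.(h',x)=(hh',x)$) to $(\Omega,\eta)$; an isomorphism of measure $G$-spaces is a measurable map restricting, between conull $G$-invariant measurable subsets, to a $G$-equivariant measurable bijection with measurable inverse that pushes one measure onto the other. *)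

theory Defs
  imports "HOL-Analysis.Analysis"
begin

text \<open>Groups are modelled as types of class group_add (NOT necessarily commutative;
  the group law is written +, the identity 0).  An lcsc group is such a type
  that is Hausdorff, second countable, locally compact, with continuous group operations.\<close>

definition lcsc_group :: "'g::{group_add,t2_space,second_countable_topology} itself \<Rightarrow> bool" where
  "lcsc_group _ \<longleftrightarrow>
     locally_compact_space (euclidean :: 'g topology) \<and>
     continuous_on UNIV (\<lambda>p::'g \<times> 'g. fst p + snd p) \<and>
     continuous_on UNIV (uminus :: 'g \<Rightarrow> 'g)"

definition haar_measure :: "'g::{group_add,topological_space} measure \<Rightarrow> bool" where
  "haar_measure m \<longleftrightarrow>
     sets m = sets borel \<and>
     (\<forall>g A. A \<in> sets borel \<longrightarrow> emeasure m ((\<lambda>x. g + x) ` A) = emeasure m A) \<and>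
     (\<forall>K. compact K \<longrightarrow> emeasure m K < \<infinity>) \<and>
     (\<forall>U. open U \<and> U \<noteq> {} \<longrightarrow> emeasure m U > 0)"

definition unimodular_haar :: "'g::{group_add,topological_space} measure \<Rightarrow> bool" where
  "unimodular_haar m \<longleftrightarrow> haar_measure m \<and>
     (\<forall>g A. A \<in> sets borel \<longrightarrow> emeasure m ((\<lambda>x. x + g) ` A) = emeasure m A)"

definition standard_borel :: "'a measure \<Rightarrow> bool" where
  "standard_borel M \<longleftrightarrow> (\<exists>T :: 'a topology. topspace T = space M \<and>
      completely_metrizable_space T \<and> second_countable T \<and>
      sets M = sigma_sets (space M) {U. openin T U})"

definition borel_iso :: "'a measure \<Rightarrow> 'b measure \<Rightarrow> ('a \<Rightarrow> 'b) \<Rightarrow> bool" where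
  "borel_iso M N f \<longleftrightarrow> f \<in> M \<rightarrow>\<^sub>M N \<and> bij_betw f (space M) (space N) \<and>
     (\<exists>f'. f' \<in> N \<rightarrow>\<^sub>M M \<and> (\<forall>x\<in>space M. f' (f x) = x) \<and> (\<forall>y\<in>space N. f (f' y) = y))"

definition iso_measure_G_spaces ::
  "('g \<Rightarrow> 'a \<Rightarrow> 'a) \<Rightarrow> 'a measure \<Rightarrow> ('g \<Rightarrow> 'b \<Rightarrow> 'b) \<Rightarrow> 'b measure \<Rightarrow> ('a \<Rightarrow> 'b) \<Rightarrow> bool" where
  "iso_measure_G_spaces a M b N f \<longleftrightarrow> f \<in> M \<rightarrow>\<^sub>M N \<and>
     (\<exists>A B. A \<in> sets M \<and> B \<in> sets N \<and>
        emeasure M (space M - A) = 0 \<and> emeasure N (space N - B) = 0 \<and>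
        (\<forall>g x. x \<in> A \<longrightarrow> a g x \<in> A) \<and> (\<forall>g y. y \<in> B \<longrightarrow> b g y \<in> B) \<and>
        (\<forall>g x. x \<in> A \<longrightarrow> f (a g x) = b g (f x)) \<and>
        borel_iso (restrict_space M A) (restrict_space N B) f \<and>
        distr (restrict_space M A) (restrict_space N B) f = restrict_space N B)"

definition mp_action :: "('g::group_add \<Rightarrow> 'h::group_add \<Rightarrow> 'w \<Rightarrow> 'w) \<Rightarrow>
    'g measure \<Rightarrow> 'h measure \<Rightarrow> 'w measure \<Rightarrow> bool" where
  "mp_action act SG SH M \<longleftrightarrow>
     (\<lambda>(g, h, t). act g h t) \<in> SG \<Otimes>\<^sub>M SH \<Otimes>\<^sub>M M \<rightarrow>\<^sub>M M \<and>
     (\<forall>t\<in>space M. act 0 0 t = t) \<and>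
     (\<forall>g1 g2 h1 h2. \<forall>t\<in>space M. act (g1 + g2) (h1 + h2) t = act g1 h1 (act g2 h2 t)) \<and>
     (\<forall>g h. distr M M (act g h) = M)"

definition me_coupling ::
  "'g::{group_add,topological_space} measure \<Rightarrow> 'h::{group_add,topological_space} measure \<Rightarrow>
   ('g \<Rightarrow> 'h \<Rightarrow> 'w \<Rightarrow> 'w) \<Rightarrow> 'w measure \<Rightarrow> 'x measure \<Rightarrow> 'y measure \<Rightarrow>
   ('g \<times> 'y \<Rightarrow> 'w) \<Rightarrow> ('h \<times> 'x \<Rightarrow> 'w) \<Rightarrow> bool" where
  "me_coupling lamG lamH act \<eta> \<mu> \<nu> i j \<longleftrightarrow>
     standard_borel \<eta> \<and> mp_action act borel borel \<eta> \<and> emeasure \<eta> (space \<eta>) \<noteq> 0 \<and>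
     standard_borel \<mu> \<and> finite_measure \<mu> \<and>
     standard_borel \<nu> \<and> finite_measure \<nu> \<and>
     iso_measure_G_spaces (\<lambda>g (g', y). (g + g', y)) (lamG \<Otimes>\<^sub>M \<nu>) (\<lambda>g t. act g 0 t) \<eta> i \<and>
     iso_measure_G_spaces (\<lambda>h (h', x). (h + h', x)) (lamH \<Otimes>\<^sub>M \<mu>) (\<lambda>h t. act 0 h t) \<eta> j"

end

(*
  Idea.  The new action is the old one, restricted to an invariant conull Borel set; all the work is
  to find such a set on which both trivializations hold everywhere.

  Let B be the conull G-invariant set on which i inverts to t |-> (p t, q t).  The set of points t
  with h.t in B for almost all h is conull and, as the actions commute and Haar measure on H is
  right invariant, invariant under G x H.  On it h |-> p (h.t) is an almost everywhere defined
  element of L^0(H, G), and L^0(H, G) has an equivariant Borel map to G: choose G-invariantly a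
  decreasing sequence of non-null subsets of H on which the function has smaller and smaller
  oscillation, and take the limit of its values.  This gives a Borel fundamental domain for G,
  consisting of a conull subset of Y and a null set N outside B.

  If the measure on Y is not atomic, Y contains a null Borel copy of the real line, and N is absorbed
  there by a Hilbert hotel.  If it is atomic, the union of the G-orbits of positive measure is already
  invariant under G x H, conull, and contained in B.  Doing this for G and for H and intersecting
  gives the set sought.
*)
theory Submission
  imports Defs "HOL-Probability.Probability"
begin

text \<open>The sets on which \<open>i\<close> and \<open>j\<close> invert are conull but invariant
  under one group only, and over an uncountable group the translates of a conull set cannot simply
  be intersected. This is why the good set is defined through almost all h, where Fubini applies.
  Such a set may contain orbits outside B, on which no coordinates are given. The equivariant map to
  G supplies them: its fibre over the identity meets each G-orbit exactly once, and stabilizers in G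
  are trivial there. The choice can be made equivariantly because translating t by g multiplies the
  values p (h.t) on the left by g, which leaves the quotient of any two values unchanged.

  The remaining obstacle is bijectivity: the orbits outside B need parameters in Y itself. When Y
  is, say, a finite set of atoms, there is no room for them, whence the case distinction.
  Intersecting the sets found for the two groups is harmless because in both cases every smaller
  invariant conull set is trivialized as well.\<close>

section \<open>Standard Borel spaces and real codes\<close>

lemma binary_expansion:
  fixes v :: real
  assumes "0 \<le> v" "v < 1"
  shows "(\<lambda>j. real_of_int (\<lfloor>2 ^ Suc j * v\<rfloor> mod 2) / 2 ^ Suc j) sums v"
proof -
  define f where "f j = real_of_int \<lfloor>2 ^ j * v\<rfloor> / 2 ^ j" for j :: nat
  \<comment> \<open>The digit terms are the increments of the truncations \<open>f j\<close>, so the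
    series telescopes; \<open>f 0 = 0\<close> is where v in [0, 1) enters.\<close>
  have step: "real_of_int (\<lfloor>2 ^ Suc j * v\<rfloor> mod 2) / 2 ^ Suc j = f (Suc j) - f j" for j
  proof -
    have "\<lfloor>2 ^ Suc j * v\<rfloor> div 2 = \<lfloor>2 ^ j * v\<rfloor>"
      using floor_divide_real_eq_div[of 2 "2 ^ Suc j * v"] by simp
    then have "\<lfloor>2 ^ Suc j * v\<rfloor> mod 2 = \<lfloor>2 ^ Suc j * v\<rfloor> - 2 * \<lfloor>2 ^ j * v\<rfloor>"
      by (metis minus_mult_div_eq_mod)
    then show ?thesis
      by (simp add: f_def field_simps)
  qed
  have "f \<longlonglongrightarrow> v"
  proof (rule tendsto_sandwich)
    show "(\<lambda>j. v - 1 / 2 ^ j) \<longlonglongrightarrow> v"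
      using tendsto_diff[OF tendsto_const LIMSEQ_inverse_realpow_zero[of 2], of v]
      by (simp add: divide_inverse)
    show "\<forall>\<^sub>F j in sequentially. v - 1 / 2 ^ j \<le> f j"
    proof (intro always_eventually allI)
      fix j :: nat
      have "2 ^ j * v - 1 \<le> real_of_int \<lfloor>2 ^ j * v\<rfloor>" by linarith
      then have "(2 ^ j * v - 1) / 2 ^ j \<le> f j"
        unfolding f_def by (rule divide_right_mono) simp
      then show "v - 1 / 2 ^ j \<le> f j"
        by (simp add: diff_divide_distrib)
    qed
    show "\<forall>\<^sub>F j in sequentially. f j \<le> v"
    proof (intro always_eventually allI)
      fix j :: nat
      have "real_of_int \<lfloor>2 ^ j * v\<rfloor> \<le> 2 ^ j * v" by linarith
      then show "f j \<le> v"
        by (simp add: f_def field_simps)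
    qed
  qed simp
  then have "(\<lambda>j. f (Suc j) - f j) sums (v - f 0)"
    by (rule telescope_sums)
  moreover have "f 0 = 0"
    using assms by (simp add: f_def floor_eq_iff)
  ultimately show ?thesis
    unfolding step by simp
qed

text \<open>Digits 0 and 1 in base 3 leave every tail at most 1/2, so rounding down reads each digit
  back without carries. In base 2 a tail of ones would spoil this.\<close>

lemma ternary_digits:
  fixes b :: "nat \<Rightarrow> int"
  assumes b: "\<And>k. b k \<in> {0, 1}"
  defines "r \<equiv> (\<Sum>k. real_of_int (b k) / 3 ^ Suc k)"
  shows "\<lfloor>3 ^ Suc k * r\<rfloor> mod 3 = b k" "0 \<le> r" "r \<le> 1 / 2"
proof -
  have geo: "(\<lambda>k. 1 / 3 ^ Suc k :: real) sums (1 / 2)"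
    using sums_mult[OF geometric_sums[of "1 / 3 :: real"], of "1 / 3"] by (simp add: power_one_over)
  have tail: "summable (\<lambda>k. real_of_int (c k) / 3 ^ Suc k)"
    "0 \<le> (\<Sum>k. real_of_int (c k) / 3 ^ Suc k)" "(\<Sum>k. real_of_int (c k) / 3 ^ Suc k) \<le> 1 / 2"
    if c: "\<And>k. c k \<in> {0, 1}" for c :: "nat \<Rightarrow> int"
  proof -
    have le: "0 \<le> real_of_int (c k) / 3 ^ Suc k" "real_of_int (c k) / 3 ^ Suc k \<le> 1 / 3 ^ Suc k" for k
      using c[of k] by (auto simp: divide_simps)
    show s: "summable (\<lambda>k. real_of_int (c k) / 3 ^ Suc k)"
      by (rule summable_comparison_test'[OF sums_summable[OF geo], of 0])
        (use le in \<open>simp only: real_norm_def abs_of_nonneg\<close>)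
    show "0 \<le> (\<Sum>k. real_of_int (c k) / 3 ^ Suc k)"
      by (rule suminf_nonneg[OF s]) (use le in auto)
    show "(\<Sum>k. real_of_int (c k) / 3 ^ Suc k) \<le> 1 / 2"
      using suminf_le[OF le(2) s sums_summable[OF geo]] sums_unique[OF geo] by simp
  qed
  show "0 \<le> r" "r \<le> 1 / 2"
    using tail[of b, OF b] by (auto simp: r_def)
  \<comment> \<open>\<open>I k\<close> will be the integer part of \<open>3 ^ Suc k * r\<close>: the
    leading digits read as a ternary integer.\<close>
  define I where "I k = (\<Sum>i<Suc k. b i * 3 ^ (k - i))" for k
  have I: "I k mod 3 = b k"
  proof -
    have "I k = 3 * (\<Sum>i<k. b i * 3 ^ (k - Suc i)) + b k"
      by (auto simp: I_def sum_distrib_left Suc_diff_Suc algebra_simps simp flip: power_Suc intro!: sum.cong)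
    then show ?thesis
      using b[of k] by auto
  qed
  have "3 ^ Suc k * r = 3 ^ Suc k * (\<Sum>i. real_of_int (b (i + Suc k)) / 3 ^ Suc (i + Suc k))
      + 3 ^ Suc k * (\<Sum>i<Suc k. real_of_int (b i) / 3 ^ Suc i)"
    unfolding r_def by (subst suminf_split_initial_segment[OF tail(1)[of b, OF b], of "Suc k"])
      (simp only: distrib_left)
  also have "3 ^ Suc k * (\<Sum>i. real_of_int (b (i + Suc k)) / 3 ^ Suc (i + Suc k))
      = (\<Sum>i. real_of_int (b (i + Suc k)) / 3 ^ Suc i)"
    using summable_ignore_initial_segment[OF tail(1)[of b, OF b], of "Suc k"]
    by (subst suminf_mult[symmetric]) (auto simp: power_add intro!: suminf_cong)
  also have "3 ^ Suc k * (\<Sum>i<Suc k. real_of_int (b i) / 3 ^ Suc i) = real_of_int (I k)"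
    unfolding I_def of_int_sum sum_distrib_left
  proof (intro sum.cong refl)
    fix i assume "i \<in> {..<Suc k}"
    then have "(3::real) ^ Suc k = 3 ^ (k - i) * 3 ^ Suc i"
      by (metis add.commute add_Suc_right le_add_diff_inverse lessThan_iff less_Suc_eq_le power_add)
    then show "3 ^ Suc k * (real_of_int (b i) / 3 ^ Suc i) = real_of_int (b i * 3 ^ (k - i))"
      by simp
  qed
  finally have "3 ^ Suc k * r = (\<Sum>i. real_of_int (b (i + Suc k)) / 3 ^ Suc i) + real_of_int (I k)" .
  moreover have "0 \<le> (\<Sum>i. real_of_int (b (i + Suc k)) / 3 ^ Suc i)"
    "(\<Sum>i. real_of_int (b (i + Suc k)) / 3 ^ Suc i) \<le> 1 / 2"
    using tail(2,3)[of "\<lambda>i. b (i + Suc k)"] b by auto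
  ultimately have "\<lfloor>3 ^ Suc k * r\<rfloor> = I k"
    by linarith
  then show "\<lfloor>3 ^ Suc k * r\<rfloor> mod 3 = b k"
    using I by simp
qed

text \<open>Each real is squeezed into (0, 1) and written in binary, and the double array of bits is
  read along \<open>prod_decode\<close> as one ternary expansion. Codes below 1 leave the later unit
  intervals free for the Hilbert hotel.\<close>

lemma real_sequence_coding:
  obtains code :: "(nat \<Rightarrow> real) \<Rightarrow> real" and decode :: "real \<Rightarrow> nat \<Rightarrow> real"
  where "code \<in> borel_measurable borel" "decode \<in> borel_measurable borel"
    "\<And>x. decode (code x) = x" "\<And>x. 0 \<le> code x" "\<And>x. code x < 1"
proof -
  define sq :: "real \<Rightarrow> real" where "sq x = (x / (1 + \<bar>x\<bar>) + 1) / 2" for x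
  define unsq :: "real \<Rightarrow> real" where "unsq v = (2 * v - 1) / (1 - \<bar>2 * v - 1\<bar>)" for v
  have unsq: "unsq (sq x) = x" for x
  proof -
    have "2 * sq x - 1 = x / (1 + \<bar>x\<bar>)"
      by (simp add: sq_def field_simps)
    moreover have "1 - \<bar>x / (1 + \<bar>x\<bar>)\<bar> = 1 / (1 + \<bar>x\<bar>)"
      by (simp add: abs_divide field_simps)
    ultimately show ?thesis
      by (simp add: unsq_def)
  qed
  have sq: "0 \<le> sq x" "sq x < 1" for x
    by (auto simp: sq_def abs_if field_simps)
  have [measurable]: "sq \<in> borel_measurable borel" "unsq \<in> borel_measurable borel"
    unfolding sq_def unsq_def by measurable
  define bit where "bit x k = (case prod_decode k of (n, j) \<Rightarrow> \<lfloor>2 ^ Suc j * sq (x n)\<rfloor> mod 2)"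
    for x :: "nat \<Rightarrow> real" and k
  define code where "code x = (\<Sum>k. real_of_int (bit x k) / 3 ^ Suc k)" for x
  define decode where "decode r n =
    unsq (\<Sum>j. real_of_int (\<lfloor>3 ^ Suc (prod_encode (n, j)) * r\<rfloor> mod 3) / 2 ^ Suc j)" for r :: real and n
  have bit: "bit x k \<in> {0, 1}" for x k
    unfolding bit_def by (auto split: prod.split)
  have [measurable]: "(\<lambda>x::nat \<Rightarrow> real. x n) \<in> borel_measurable borel" for n
    by (rule borel_measurable_continuous_onI) (rule continuous_on_product_coordinates)
  show thesis
  proof (rule that)
    show "code \<in> borel_measurable borel"
      unfolding code_def bit_def by (simp add: split_beta) measurable
    show "decode \<in> borel_measurable borel"
      unfolding decode_def by (intro measurable_coordinatewise_then_product) measurable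
    show "decode (code x) = x" for x
    proof
      fix n
      have "\<lfloor>3 ^ Suc (prod_encode (n, j)) * code x\<rfloor> mod 3 = \<lfloor>2 ^ Suc j * sq (x n)\<rfloor> mod 2" for j
        using ternary_digits(1)[of "bit x" "prod_encode (n, j)", OF bit]
        unfolding code_def by (simp add: bit_def)
      then show "decode (code x) n = x n"
        unfolding decode_def
        using sums_unique[OF binary_expansion[OF sq, of "x n"]] unsq[of "x n"] by simp
    qed
    show "0 \<le> code x" "code x < 1" for x
      using ternary_digits(2,3)[of "bit x", OF bit] unfolding code_def by auto
  qed
qed

text \<open>A point is coded by its distances to a dense sequence; completeness makes the image of this coding
  a Borel set given by countably many conditions.\<close>

lemma standard_borel_real_embedding:
  assumes "standard_borel M" "space M \<noteq> {}"
  obtains e :: "'a \<Rightarrow> real" and e' where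
    "e \<in> borel_measurable M" "e' \<in> borel \<rightarrow>\<^sub>M M" "\<And>x. x \<in> space M \<Longrightarrow> e' (e x) = x"
    "\<And>x. 0 \<le> e x" "\<And>x. e x < 1"
proof -
  from assms(1) obtain T where T: "topspace T = space M" "completely_metrizable_space T"
    "second_countable T" "sets M = sigma_sets (space M) {U. openin T U}"
    unfolding standard_borel_def by blast
  from T(2) obtain S d where Sd: "Metric_space S d" "Metric_space.mcomplete S d" "T = Metric_space.mtopology S d"
    unfolding completely_metrizable_space_def by blast
  interpret Metric_space S d by fact
  have S: "S = space M"
    using T(1) Sd(3) by simp
  obtain C where C: "countable C" "C \<subseteq> S" "mtopology closure_of C = S"
    using second_countable_imp_separable_space[OF T(3)] unfolding Sd(3) separable_space_def by auto
  have "C \<noteq> {}"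
    using C(3) assms(2) S by auto
  define s where "s = from_nat_into C"
  have s: "s n \<in> S" for n
    using from_nat_into[OF \<open>C \<noteq> {}\<close>] C(2) unfolding s_def by blast
  have dense: "\<exists>n. d x (s n) < r" if x: "x \<in> S" and r: "r > 0" for x r
  proof -
    have "x \<in> mtopology closure_of C"
      using that C by simp
    then obtain y where "y \<in> C" "y \<in> mball x r"
      using r unfolding metric_closure_of by blast
    then show ?thesis
      using from_nat_into_surj[OF C(1), of y] unfolding s_def by auto
  qed
  obtain x0 where x0: "x0 \<in> S"
    using assms(2) S by auto
  define f where "f x n = (if x \<in> S then d x (s n) else 0)" for x n
  have mf: "f \<in> borel_measurable M"
  proof (rule measurable_coordinatewise_then_product)
    fix n
    show "(\<lambda>x. f x n) \<in> borel_measurable M"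
      unfolding borel_measurable_iff_less
    proof
      fix a
      have "{w \<in> space M. f w n < a} = mball (s n) a"
        using s[of n] by (auto simp: f_def S[symmetric] commute)
      also have "\<dots> \<in> sets M"
        unfolding T(4) Sd(3) by (rule sigma_sets.Basic) simp
      finally show "{w \<in> space M. f w n < a} \<in> sets M" .
    qed
  qed
  \<comment> \<open>The inequalities say that \<open>z\<close> could be the distances from one
    further point to the \<open>s n\<close>; values arbitrarily near zero put this point into the
    completion of \<open>S\<close>, hence into \<open>S\<close>.\<close>
  define R where "R = {z::nat \<Rightarrow> real. (\<forall>k. \<exists>n. z n < 1 / real (Suc k)) \<and>
      (\<forall>m n. d (s n) (s m) \<le> z n + z m \<and> \<bar>z m - z n\<bar> \<le> d (s n) (s m))}"
  have [measurable]: "(\<lambda>x::nat \<Rightarrow> real. x n) \<in> borel_measurable borel" for n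
    by (rule borel_measurable_continuous_onI) (rule continuous_on_product_coordinates)
  have [measurable]: "R \<in> sets borel"
    unfolding R_def by measurable
  have fR: "f x \<in> R" if "x \<in> S" for x
  proof -
    have "\<exists>n. d x (s n) < 1 / real (Suc k)" for k
      by (rule dense[OF that]) simp
    moreover have "d (s n) (s m) \<le> d x (s n) + d x (s m)" for m n
      using triangle[of "s n" x "s m"] that s commute by metis
    moreover have "\<bar>d x (s m) - d x (s n)\<bar> \<le> d (s n) (s m)" for m n
      using triangle[of x "s n" "s m"] triangle[of x "s m" "s n"] that s commute[of "s m" "s n"]
      by (simp add: abs_le_iff algebra_simps)
    ultimately show ?thesis
      using that by (simp add: R_def f_def)
  qed
  have ex: "\<exists>x\<in>S. f x = z" if "z \<in> R" for z
  proof -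
    from that have "\<forall>k. \<exists>n. z n < 1 / real (Suc k)" and
      z: "\<And>m n. d (s n) (s m) \<le> z n + z m" "\<And>m n. \<bar>z m - z n\<bar> \<le> d (s n) (s m)"
      by (auto simp: R_def)
    then obtain n where n: "\<And>k. z (n k) < 1 / real (Suc k)"
      by metis
    have "MCauchy (\<lambda>k. s (n k))"
      unfolding MCauchy_def
    proof (intro conjI allI impI)
      show "range (\<lambda>k. s (n k)) \<subseteq> S"
        using s by auto
      fix r :: real assume "r > 0"
      then obtain N where N: "1 / real (Suc N) < r / 2"
        using nat_approx_posE[of "r / 2"] by auto
      show "\<exists>N. \<forall>k k'. N \<le> k \<longrightarrow> N \<le> k' \<longrightarrow> d (s (n k)) (s (n k')) < r"
      proof (intro exI allI impI)
        fix k k' assume "N \<le> k" "N \<le> k'"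
        then have "1 / real (Suc k) \<le> 1 / real (Suc N)" "1 / real (Suc k') \<le> 1 / real (Suc N)"
          by (auto simp: frac_le)
        then show "d (s (n k)) (s (n k')) < r"
          using z(1)[of "n k" "n k'"] n[of k] n[of k'] N by linarith
      qed
    qed
    then obtain x where "limitin mtopology (\<lambda>k. s (n k)) x sequentially"
      using Sd(2) unfolding mcomplete_def by blast
    then have x: "x \<in> S" "(\<lambda>k. d (s (n k)) x) \<longlonglongrightarrow> 0"
      unfolding limitin_metric_dist_null by auto
    have z0: "(\<lambda>k. z (n k)) \<longlonglongrightarrow> 0"
    proof (rule tendsto_sandwich)
      show "\<forall>\<^sub>F k in sequentially. 0 \<le> z (n k)"
        using z(1)[of "n k" "n k" for k] s by (auto intro!: always_eventually)
      show "\<forall>\<^sub>F k in sequentially. z (n k) \<le> 1 / real (Suc k)"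
        using n by (auto intro!: always_eventually less_imp_le)
      show "(\<lambda>k. 1 / real (Suc k)) \<longlonglongrightarrow> 0"
        using LIMSEQ_inverse_real_of_nat by (simp add: inverse_eq_divide)
    qed simp
    have "d x (s m) = z m" for m
    proof -
      have "(\<lambda>k. d (s (n k)) (s m)) \<longlonglongrightarrow> d x (s m)"
      proof (rule LIM_zero_cancel, rule Lim_null_comparison)
        show "\<forall>\<^sub>F k in sequentially. norm (d (s (n k)) (s m) - d x (s m)) \<le> d (s (n k)) x"
          using triangle[of "s (n k)" x "s m" for k] triangle[of x "s (n k)" "s m" for k] x(1) s
            commute[of x "s (n k)" for k]
          by (intro always_eventually) (auto simp: abs_le_iff algebra_simps)
      qed fact
      moreover have "(\<lambda>k. d (s (n k)) (s m)) \<longlonglongrightarrow> z m"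
      proof (rule tendsto_sandwich)
        show "\<forall>\<^sub>F k in sequentially. z m - z (n k) \<le> d (s (n k)) (s m)"
          using z(2)[of m "n k" for k] by (intro always_eventually) (auto simp: abs_le_iff algebra_simps)
        show "\<forall>\<^sub>F k in sequentially. d (s (n k)) (s m) \<le> z m + z (n k)"
          using z(1)[of "n k" m for k] by (intro always_eventually) (auto simp: algebra_simps)
        show "(\<lambda>k. z m - z (n k)) \<longlonglongrightarrow> z m" "(\<lambda>k. z m + z (n k)) \<longlonglongrightarrow> z m"
          using tendsto_diff[OF tendsto_const z0] tendsto_add[OF tendsto_const z0] by auto
      qed
      ultimately show ?thesis
        using LIMSEQ_unique by blast
    qed
    then show ?thesis
      using x(1) by (intro bexI[of _ x]) (auto simp: f_def)
  qed
  have inj: "x = y" if x: "x \<in> S" "y \<in> S" and eq: "f x = f y" for x y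
  proof (rule ccontr)
    assume "x \<noteq> y"
    then have "d x y / 2 > 0"
      using x by simp
    then obtain n where n: "d x (s n) < d x y / 2"
      using dense[OF x(1)] by blast
    have "d y (s n) = d x (s n)"
      using fun_cong[OF eq, of n] x by (simp add: f_def)
    then show False
      using triangle[OF x(1) s[of n] x(2)] n commute[of y "s n"] by linarith
  qed
  define g where "g z = (if z \<in> R then (SOME x. x \<in> S \<and> f x = z) else x0)" for z
  have g: "g z \<in> S" "f (g z) = z" if "z \<in> R" for z
    using someI_ex[of "\<lambda>x. x \<in> S \<and> f x = z"] ex[OF that] that by (auto simp: g_def)
  have gf: "g (f x) = x" if "x \<in> S" for x
    using inj[OF g(1)[OF fR[OF that]] that g(2)[OF fR[OF that]]] .
  have mg: "g \<in> borel \<rightarrow>\<^sub>M M"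
  proof (rule measurable_sigma_sets[OF T(4)])
    show "{U. openin T U} \<subseteq> Pow (space M)"
      using openin_subset T(1) by blast
    show "g \<in> space borel \<rightarrow> space M"
      using g(1) x0 S by (auto simp: g_def)
    fix U assume "U \<in> {U. openin T U}"
    then have U: "openin mtopology U" using Sd(3) by simp
    \<comment> \<open>Whether \<open>g z\<close> lies in a ball about \<open>s n\<close> is read off
      the single coordinate \<open>z n\<close>. Countably many such balls exhaust \<open>U\<close>,
      so its preimage is a Borel condition on \<open>z\<close>.\<close>
    have eq: "z \<in> R \<Longrightarrow> g z \<in> U \<longleftrightarrow> (\<exists>n k. mball (s n) (1 / real (Suc k)) \<subseteq> U \<and> z n < 1 / real (Suc k))" for z
    proof safe
      assume z: "z \<in> R" "g z \<in> U"
      obtain r where r: "r > 0" "mball (g z) r \<subseteq> U"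
        using U z(2) unfolding openin_mtopology by blast
      obtain k where k: "1 / real (Suc k) < r / 2"
        using nat_approx_posE[of "r / 2"] r by auto
      obtain n where n: "d (g z) (s n) < 1 / real (Suc k)"
        using dense[OF g(1)[OF z(1)], of "1 / real (Suc k)"] by auto
      have "mball (s n) (1 / real (Suc k)) \<subseteq> mball (g z) r"
      proof
        fix y assume y: "y \<in> mball (s n) (1 / real (Suc k))"
        then have "d (s n) y < 1 / real (Suc k)" "y \<in> S" by auto
        then show "y \<in> mball (g z) r"
          using triangle[of "g z" "s n" y] g(1)[OF z(1)] s[of n] n k by simp
      qed
      moreover have "z n < 1 / real (Suc k)"
        using n fun_cong[OF g(2)[OF z(1)], of n] g(1)[OF z(1)] by (simp add: f_def)
      ultimately show "\<exists>n k. mball (s n) (1 / real (Suc k)) \<subseteq> U \<and> z n < 1 / real (Suc k)"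
        using r by blast
    next
      fix n k assume z: "z \<in> R" and nk: "mball (s n) (1 / real (Suc k)) \<subseteq> U" "z n < 1 / real (Suc k)"
      have "d (g z) (s n) = z n"
        using fun_cong[OF g(2)[OF z(1)], of n] g(1)[OF z(1)] by (simp add: f_def)
      then have "g z \<in> mball (s n) (1 / real (Suc k))"
        using nk(2) g(1)[OF z] s[of n] by (simp add: commute)
      then show "g z \<in> U"
        using nk(1) by blast
    qed
    have eq': "g z \<in> U \<longleftrightarrow> (if z \<in> R then (\<exists>n k. mball (s n) (1 / real (Suc k)) \<subseteq> U \<and> z n < 1 / real (Suc k)) else x0 \<in> U)" for z
      by (cases "z \<in> R") (simp_all only: eq if_True if_False, simp add: g_def)
    have "g -` U \<inter> space borel = {z. if z \<in> R then (\<exists>n k. mball (s n) (1 / real (Suc k)) \<subseteq> U \<and> z n < 1 / real (Suc k)) else x0 \<in> U}"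
      by (simp only: vimage_def eq') simp
    also have "\<dots> \<in> sets borel"
      by measurable
    finally show "g -` U \<inter> space borel \<in> sets borel" .
  qed
  obtain code :: "(nat \<Rightarrow> real) \<Rightarrow> real" and decode :: "real \<Rightarrow> nat \<Rightarrow> real" where code: "code \<in> borel_measurable borel"
    "decode \<in> borel_measurable borel" "\<And>x. decode (code x) = x" "\<And>x. 0 \<le> code x" "\<And>x. code x < 1"
    by (rule real_sequence_coding[OF that])
  show thesis
  proof (rule that[of "\<lambda>x. code (f x)" "\<lambda>r. g (decode r)"])
    show "(\<lambda>x. code (f x)) \<in> borel_measurable M" "(\<lambda>r. g (decode r)) \<in> borel \<rightarrow>\<^sub>M M"
      using mf mg code(1,2) by measurable
  qed (use code gf S in auto)
qed

section \<open>Null copies of the real line\<close>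

text \<open>\<open>F\<close> is the distribution function and \<open>Q\<close> the quantile
  function. Without atoms \<open>F\<close> is continuous, so it takes the value u at
  \<open>Q u\<close>, and \<open>Q\<close> embeds the interval (0, c] into \<open>K\<close>;
  compactness keeps the infima in \<open>K\<close>.\<close>

lemma atomless_quantile:
  fixes m :: "real measure"
  assumes "finite_measure m" "sets m = sets borel" "\<And>x. emeasure m {x} = 0"
    and K: "compact K" "emeasure m (- K) = 0" and "emeasure m UNIV \<noteq> 0"
  obtains Q F :: "real \<Rightarrow> real" and c where
    "Q \<in> borel_measurable borel" "F \<in> borel_measurable borel" "c > 0"
    "\<And>u. Q u \<in> K" "\<And>u. 0 < u \<Longrightarrow> u \<le> c \<Longrightarrow> F (Q u) = u"
proof -
  interpret finite_measure m by fact
  interpret finite_borel_measure m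
    by unfold_locales (use assms(2) in auto)
  have sp: "space m = UNIV"
    using sets_eq_imp_space_eq[OF assms(2)] by simp
  have [measurable]: "K \<in> sets borel"
    using K(1) by (simp add: borel_compact)
  define F where "F = cdf m"
  define c where "c = measure m UNIV"
  have "c > 0"
    using assms(6) measure_nonneg[of m UNIV] unfolding c_def by (auto simp: emeasure_eq_measure less_le)
  have FK: "F x = measure m (K \<inter> {..x})" for x
  proof -
    have "{..x} - K \<in> null_sets m"
      by (rule null_sets_subset[of "- K"]) (use K(2) assms(2) in auto)
    then have "measure m ({..x} - ({..x} - K)) = measure m {..x}"
      by (intro measure_Diff_null_set) (auto simp: assms(2))
    moreover have "{..x} - ({..x} - K) = K \<inter> {..x}" by auto
    ultimately show ?thesis
      by (simp add: F_def cdf_def)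
  qed
  have mono: "F x \<le> F y" if "x \<le> y" for x y
    unfolding F_def using that by (rule cdf_nondecreasing)
  have cont: "isCont F x" for x
    unfolding F_def isCont_cdf using assms(3)[of x] by (simp add: measure_def)
  have "K \<noteq> {}"
  proof
    assume "K = {}"
    then show False using K(2) assms(6) by simp
  qed
  obtain x1 where x1: "x1 \<in> K" "\<And>x. x \<in> K \<Longrightarrow> x \<le> x1"
    using compact_attains_sup[OF K(1) \<open>K \<noteq> {}\<close>] by blast
  have "F x1 = c"
  proof -
    have "K \<inter> {..x1} = UNIV - (- K)"
      using x1 by auto
    moreover have "measure m (UNIV - (- K)) = measure m UNIV"
      by (intro measure_Diff_null_set) (use K(2) assms(2) in auto)
    ultimately show ?thesis
      by (simp add: FK c_def)
  qed
  \<comment> \<open>Capping u at the total mass \<open>c\<close> keeps \<open>L u\<close> nonempty,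
    so \<open>Q\<close> is defined on all reals with values in \<open>K\<close>.\<close>
  define L where "L u = {x \<in> K. min u c \<le> F x}" for u
  have Lne: "L u \<noteq> {}" for u
    using x1(1) \<open>F x1 = c\<close> by (auto simp: L_def)
  have Lcl: "closed (L u)" for u
  proof -
    have "L u = K \<inter> {x. min u c \<le> F x}"
      by (auto simp: L_def)
    moreover have "closed {x. min u c \<le> F x}"
      by (rule closed_Collect_le) (auto intro!: continuous_at_imp_continuous_on cont)
    ultimately show ?thesis
      using compact_imp_closed[OF K(1)] by auto
  qed
  have Lbb: "bdd_below (L u)" for u
    by (rule bdd_below_mono[OF bounded_imp_bdd_below[OF compact_imp_bounded[OF K(1)]]]) (auto simp: L_def)
  define Q where "Q u = Inf (L u)" for u
  have QL: "Q u \<in> L u" for u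
    unfolding Q_def by (rule closed_contains_Inf[OF Lne Lbb Lcl])
  have "mono Q"
    unfolding Q_def by (intro monoI cInf_superset_mono[OF Lne Lbb]) (auto simp: L_def)
  have FQ: "F (Q u) = u" if u: "0 < u" "u \<le> c" for u
  proof (rule ccontr)
    assume "F (Q u) \<noteq> u"
    then have "u < F (Q u)"
      using QL[of u] u by (auto simp: L_def)
    then have "\<forall>\<^sub>F x in at (Q u). u < F x"
      using cont[of "Q u"] unfolding isCont_def by (auto dest: order_tendstoD(1))
    then obtain d where d: "d > 0" "\<And>x. x \<noteq> Q u \<Longrightarrow> dist x (Q u) < d \<Longrightarrow> u < F x"
      unfolding eventually_at by auto
    define x where "x = Q u - d / 2"
    have x: "u < F x" "x < Q u"
      using d by (auto simp: x_def dist_real_def)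
    have "K \<inter> {..x} \<noteq> {}"
    proof
      assume "K \<inter> {..x} = {}"
      then show False
        using x(1) u(1) unfolding FK by simp
    qed
    moreover have "compact (K \<inter> {..x})"
      using K(1) by (intro compact_Int_closed) auto
    \<comment> \<open>\<open>x\<close> may lie in a gap of \<open>K\<close>. The largest point of
      \<open>K\<close> below it has the same value of \<open>F\<close>, because \<open>m\<close> is
      carried by \<open>K\<close>, and so it contradicts the minimality of
      \<open>Q u\<close>.\<close>
    ultimately obtain y where y: "y \<in> K \<inter> {..x}" "\<And>z. z \<in> K \<inter> {..x} \<Longrightarrow> z \<le> y"
      using compact_attains_sup[of "K \<inter> {..x}"] by metis
    have "K \<inter> {..y} = K \<inter> {..x}"
    proof
      show "K \<inter> {..y} \<subseteq> K \<inter> {..x}"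
        using y(1) by auto
      show "K \<inter> {..x} \<subseteq> K \<inter> {..y}"
        using y(2) by auto
    qed
    then have "F y = F x"
      by (simp add: FK)
    then have "y \<in> L u"
      using y(1) x(1) by (auto simp: L_def)
    then have "Q u \<le> y"
      unfolding Q_def by (intro cInf_lower Lbb)
    then show False
      using y(1) x(2) by auto
  qed
  show thesis
  proof (rule that)
    show "Q \<in> borel_measurable borel"
      by (rule borel_measurable_mono) fact
    show "F \<in> borel_measurable borel"
      by (rule borel_measurable_mono) (auto intro!: monoI mono)
    show "Q u \<in> K" for u
      using QL[of u] by (auto simp: L_def)
  qed (use FQ \<open>c > 0\<close> in auto)
qed

text \<open>Nullity is free: a Borel copy of the plane consists of uncountably many disjoint copies of the
  line, and only countably many of them can have positive measure.\<close>

lemma null_copy_of_real: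
  assumes "standard_borel N" "finite_measure N" "Y \<in> sets N"
    and pos: "emeasure N {y \<in> Y. emeasure N {y} = 0} \<noteq> 0"
  obtains z :: "real \<Rightarrow> 'a" and z' where
    "z \<in> borel \<rightarrow>\<^sub>M N" "z' \<in> borel_measurable N" "\<And>x. z' (z x) = x" "\<And>x. z x \<in> Y"
    "range z \<in> null_sets N"
proof -
  interpret finite_measure N by fact
  have "space N \<noteq> {}"
  proof
    assume "space N = {}"
    then have "{y \<in> Y. emeasure N {y} = 0} = {}"
      using sets.sets_into_space[OF assms(3)] by auto
    then show False using pos by (metis emeasure_empty)
  qed
  then obtain e :: "'a \<Rightarrow> real" and e' where e[measurable]: "e \<in> borel_measurable N" "e' \<in> borel \<rightarrow>\<^sub>M N"
    and e'e: "\<And>x. x \<in> space N \<Longrightarrow> e' (e x) = x"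
    using standard_borel_real_embedding[OF assms(1)] by metis
  have e'sp: "e' r \<in> space N" for r
    using measurable_space[OF e(2)] by simp
  have [measurable]: "Y \<in> sets N" by fact
  have sing: "{y} \<in> sets N" if "y \<in> space N" for y
  proof -
    have "{y} = {x \<in> space N. e x = e y}"
      using that e'e by (auto intro: arg_cong[where f = e']) metis
    also have "\<dots> \<in> sets N" by measurable
    finally show ?thesis .
  qed
  define D where "D = {y \<in> space N. measure N {y} \<noteq> 0}"
  have "D \<subseteq> {y. measure N {y} \<noteq> 0}"
    by (simp add: D_def subset_eq)
  then have "countable D"
    by (rule countable_subset[OF _ countable_support])
  have Dsp: "y \<in> space N" if "y \<in> D" for y
    using that by (simp add: D_def)
  have [measurable]: "D \<in> sets N"
    by (rule sets.countable[OF sing[OF Dsp] \<open>countable D\<close>])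
  have YD: "{y \<in> Y. emeasure N {y} = 0} = Y - D"
    using sets.sets_into_space[OF assms(3)] by (auto simp: D_def emeasure_eq_measure)
  \<comment> \<open>The equation \<open>e (e' r) = r\<close> describes the image of \<open>e\<close>
    without forming a direct image.\<close>
  define E where "E = {r. e' r \<in> Y - D \<and> e (e' r) = r}"
  have [measurable]: "E \<in> sets borel"
    unfolding E_def by measurable
  define m0 where "m0 = distr N borel e"
  have "emeasure m0 E = emeasure N (Y - D)"
    unfolding m0_def
    by (subst emeasure_distr) (use e'e sets.sets_into_space[OF assms(3)] in
      \<open>auto simp: E_def intro!: arg_cong[where f = "emeasure N"]\<close>)
  then have m0E: "emeasure m0 E \<noteq> 0"
    using pos YD by simp
  interpret m0: finite_measure m0
    unfolding m0_def by (rule finite_measure_distr) measurable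
  have "emeasure m0 E = (SUP K\<in>{K. K \<subseteq> E \<and> compact K}. emeasure m0 K)"
    by (rule inner_regular) (use m0.emeasure_finite in \<open>auto simp: m0_def\<close>)
  then obtain K where K: "K \<subseteq> E" "compact K" "emeasure m0 K \<noteq> 0"
    using m0E by (metis (mono_tags, lifting) SUP_eq_const SUP_least bot_ennreal le_zero_eq mem_Collect_eq zero_le)
  have [measurable]: "K \<in> sets borel"
    using K(2) by (rule borel_compact)
  define m where "m = density m0 (indicator K)"
  have m: "emeasure m B = emeasure m0 (K \<inter> B)" if "B \<in> sets borel" for B
    unfolding m_def by (rule emeasure_restricted) (use that in \<open>auto simp: m0_def\<close>)
  have setsm: "sets m = sets borel"
    by (simp add: m_def m0_def)
  have "finite_measure m"
    by (rule finite_measureI) (use sets_eq_imp_space_eq[OF setsm] m[of UNIV] in auto)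
  moreover have "emeasure m {x} = 0" for x
  proof (cases "x \<in> K")
    case True
    then have x: "e' x \<in> Y - D" "e (e' x) = x"
      using K(1) by (auto simp: E_def)
    have "emeasure m {x} = emeasure m0 {x}"
      using True by (subst m) auto
    also have "\<dots> = emeasure N {e' x}"
      unfolding m0_def using x e'e e'sp
      by (subst emeasure_distr) (auto intro!: arg_cong[where f = "emeasure N"])
    also have "\<dots> = 0"
      using x e'sp by (auto simp: D_def emeasure_eq_measure)
    finally show ?thesis .
  qed (auto simp: m)
  moreover have "emeasure m (- K) = 0" "emeasure m UNIV \<noteq> 0"
    using K(3) by (auto simp: m)
  ultimately obtain Q F :: "real \<Rightarrow> real" and c where
    QF[measurable]: "Q \<in> borel_measurable borel" "F \<in> borel_measurable borel"
    and QF': "c > 0" "\<And>u. Q u \<in> K" "\<And>u. 0 < u \<Longrightarrow> u \<le> c \<Longrightarrow> F (Q u) = u"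
    using atomless_quantile[OF _ setsm _ K(2)] by metis
  obtain code :: "(nat \<Rightarrow> real) \<Rightarrow> real" and decode :: "real \<Rightarrow> nat \<Rightarrow> real" where
    code[measurable]: "code \<in> borel_measurable borel" "decode \<in> borel_measurable borel"
    and code': "\<And>x. decode (code x) = x" "\<And>x. 0 \<le> code x" "\<And>x. code x < 1"
    by (rule real_sequence_coding[OF that])
  have [measurable]: "(\<lambda>x::nat \<Rightarrow> real. x n) \<in> borel_measurable borel" for n
    by (rule borel_measurable_continuous_onI) (rule continuous_on_product_coordinates)
  have [measurable]: "(\<lambda>b n. if n = (0::nat) then a else b) \<in> borel_measurable borel" for a :: real
    by (rule measurable_coordinatewise_then_product) auto
  \<comment> \<open>The pair is stored as the sequence a, b, b, ...; the affine map puts its code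
    into [c/2, c), where \<open>F\<close> inverts \<open>Q\<close>.\<close>
  define u where "u a b = c * (1 + code (\<lambda>n. if n = 0 then a else b)) / 2" for a b
  have u: "0 < u a b" "u a b \<le> c" for a b
  proof -
    show "0 < u a b"
      unfolding u_def using QF'(1) code'(2)[of "\<lambda>n. if n = 0 then a else b"] by simp
    have "c * (1 + code (\<lambda>n. if n = 0 then a else b)) \<le> c * 2"
      using QF'(1) code'(3)[of "\<lambda>n. if n = 0 then a else b"] by simp
    then show "u a b \<le> c"
      unfolding u_def by simp
  qed
  define v where "v y n = decode (2 * F (e y) / c - 1) n" for y n
  define z where "z a b = e' (Q (u a b))" for a b
  have ez: "e (z a b) = Q (u a b)" "z a b \<in> Y" for a b
    using K(1) QF'(2)[of "u a b"] by (auto simp: E_def z_def)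
  have vz: "v (z a b) = (\<lambda>n. if n = 0 then a else b)" for a b
    using QF'(1) unfolding v_def ez QF'(3)[OF u] by (simp add: u_def code')
  have [measurable]: "(\<lambda>y. v y n) \<in> borel_measurable N" for n
    unfolding v_def by measurable
  have [measurable]: "z a \<in> borel \<rightarrow>\<^sub>M N" for a
    unfolding z_def u_def by measurable
  define m1 where "m1 = distr N borel (\<lambda>y. v y 0)"
  interpret m1: finite_measure m1
    unfolding m1_def by (rule finite_measure_distr) measurable
  obtain a where a: "measure m1 {a} = 0"
    using m1.countable_support uncountable_UNIV_real by (metis (mono_tags, lifting) UNIV_I countable_subset mem_Collect_eq subsetI)
  show thesis
  proof (rule that[of "z a" "\<lambda>y. v y 1"])
    \<comment> \<open>The image is Borel because it is the fixed set of the retraction taking y to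
      \<open>z a (v y 1)\<close>; equality of points is tested through the real code
      \<open>e\<close>.\<close>
    have "range (z a) = {y \<in> space N. e y = e (z a (v y 1))}" (is "_ = ?R")
    proof
      show "range (z a) \<subseteq> ?R"
        using ez(2) sets.sets_into_space[OF assms(3)] by (auto simp: vz)
      show "?R \<subseteq> range (z a)"
      proof
        fix y assume "y \<in> ?R"
        then have "y \<in> space N" "e y = e (z a (v y 1))" by auto
        then have "y = z a (v y 1)"
          using e'e ez(2) sets.sets_into_space[OF assms(3)] by (metis subsetD)
        then show "y \<in> range (z a)" by (rule range_eqI)
      qed
    qed
    also have "\<dots> \<in> sets N" by measurable
    finally have R: "range (z a) \<in> sets N" .
    have sub: "range (z a) \<subseteq> (\<lambda>y. v y 0) -` {a} \<inter> space N"
      using ez(2) sets.sets_into_space[OF assms(3)] by (auto simp: vz)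
    have "emeasure N ((\<lambda>y. v y 0) -` {a} \<inter> space N) = emeasure m1 {a}"
      unfolding m1_def by (subst emeasure_distr) auto
    also have "\<dots> = 0"
      using a by (simp add: m1.emeasure_eq_measure)
    finally have "(\<lambda>y. v y 0) -` {a} \<inter> space N \<in> null_sets N"
      by (intro null_setsI) auto
    then show "range (z a) \<in> null_sets N"
      using R sub by (rule null_sets_subset)
  qed (auto simp: vz ez)
qed

section \<open>An equivariant choice of a value of a measurable function\<close>

text \<open>Boolean expressions over a sequence of sets. The type is countable, so the values of its
  terms enumerate the generated algebra.\<close>

datatype set_term = Base nat | Compl set_term | Join set_term set_term

instance set_term :: countable
  by countable_datatype

text \<open>The sets approximable by values of terms form a sigma algebra: complements keep the
  symmetric difference, errors add under unions, and a countable union is first cut off at a finite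
  stage by continuity of the measure.\<close>

lemma countable_dense_measure_algebra:
  assumes "finite_measure M" and G: "sets M = sigma_sets (space M) G" "countable G"
  obtains A :: "nat \<Rightarrow> 'a set" where "range A \<subseteq> sets M"
    "\<And>P r. P \<in> sets M \<Longrightarrow> 0 < r \<Longrightarrow> \<exists>k. measure M (P - A k \<union> (A k - P)) < r"
proof -
  interpret finite_measure M by fact
  have Gs: "G \<subseteq> sets M"
    unfolding G(1) by auto
  define B where "B n = (if G = {} then {} else from_nat_into G n)" for n
  have B: "B n \<in> sets M" for n
    using Gs from_nat_into[of G n] by (auto simp: B_def)
  define val where "val = rec_set_term B (\<lambda>_ X. space M - X) (\<lambda>_ _ X Y. X \<union> Y)"
  have val [simp]: "val (Base n) = B n" "val (Compl s) = space M - val s"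
    "val (Join s s') = val s \<union> val s'" for n s s'
    by (simp_all add: val_def)
  have val_sets [measurable]: "val s \<in> sets M" for s
    by (induction s) (auto simp: B)
  define appr where "appr P \<longleftrightarrow> P \<in> sets M \<and> (\<forall>r>0. \<exists>s. measure M (P - val s \<union> (val s - P)) < r)" for P
  have val_appr: "appr (val s)" for s
    unfolding appr_def by (auto intro!: exI[of _ s])
  have union: "appr (P \<union> Q)" if "appr P" "appr Q" for P Q
  proof -
    have [measurable]: "P \<in> sets M" "Q \<in> sets M" using that by (auto simp: appr_def)
    have "\<exists>s. measure M (P \<union> Q - val s \<union> (val s - (P \<union> Q))) < r" if r: "r > 0" for r
    proof -
      from r have "r / 2 > 0" by simp
      then obtain s s' where s: "measure M (P - val s \<union> (val s - P)) < r / 2"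
        "measure M (Q - val s' \<union> (val s' - Q)) < r / 2"
        using \<open>appr P\<close> \<open>appr Q\<close> unfolding appr_def by meson
      have "measure M (P \<union> Q - val (Join s s') \<union> (val (Join s s') - (P \<union> Q)))
          \<le> measure M ((P - val s \<union> (val s - P)) \<union> (Q - val s' \<union> (val s' - Q)))"
        by (intro finite_measure_mono) auto
      also have "\<dots> \<le> measure M (P - val s \<union> (val s - P)) + measure M (Q - val s' \<union> (val s' - Q))"
        by (intro measure_Un_le) auto
      finally show ?thesis
        using s by (intro exI[of _ "Join s s'"]) linarith
    qed
    then show ?thesis by (simp add: appr_def)
  qed
  have "appr P" if "P \<in> sigma_sets (space M) G" for P
    using that
  proof induction
    case (Basic a)
    then have "\<exists>n. a = B n"
      using from_nat_into_surj[OF G(2), of a] by (auto simp: B_def)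
    then show ?case
      using val_appr[of "Base n" for n] by auto
  next
    case Empty
    show ?case
      using val_appr[of "Compl (Join (Base 0) (Compl (Base 0)))"] sets.sets_into_space[OF B[of 0]]
      by (simp add: Un_absorb1)
  next
    case (Compl a)
    then have a: "a \<in> sets M" "a \<subseteq> space M" using sets.sets_into_space by (auto simp: appr_def)
    have "\<exists>s. measure M (space M - a - val s \<union> (val s - (space M - a))) < r" if r: "r > 0" for r
    proof -
      obtain s where s: "measure M (a - val s \<union> (val s - a)) < r"
        using Compl.IH r unfolding appr_def by blast
      have "space M - a - val (set_term.Compl s) \<union> (val (set_term.Compl s) - (space M - a))
          = a - val s \<union> (val s - a)"
        using a sets.sets_into_space[OF val_sets[of s]] by auto
      then show ?thesis
        using s by (intro exI[of _ "set_term.Compl s"]) simp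
    qed
    then show ?case using a by (auto simp: appr_def)
  next
    case (Union a)
    have [measurable]: "a i \<in> sets M" for i using Union.IH by (simp add: appr_def)
    have fin: "appr (\<Union>i<n. a i)" for n
    proof (induction n)
      case 0
      then show ?case
        using val_appr[of "Compl (Join (Base 0) (Compl (Base 0)))"] sets.sets_into_space[OF B[of 0]]
        by (simp add: Un_absorb1)
    next
      case (Suc n)
      then show ?case
        using union[OF Union.IH[of n] Suc.IH] by (simp add: lessThan_Suc)
    qed
    have "\<exists>s. measure M ((\<Union>i. a i) - val s \<union> (val s - (\<Union>i. a i))) < r" if r: "r > 0" for r
    proof -
      have "(\<lambda>n. measure M (\<Union>i<n. a i)) \<longlonglongrightarrow> measure M (\<Union>n. \<Union>i<n. a i)"
        by (intro finite_Lim_measure_incseq) (auto simp: incseq_def intro: less_le_trans)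
      moreover have "(\<Union>n. \<Union>i<n. a i) = (\<Union>i. a i)" by auto
      ultimately have "\<forall>\<^sub>F n in sequentially. measure M (\<Union>i. a i) - r / 2 < measure M (\<Union>i<n. a i)"
        using r by (intro order_tendstoD(1)) auto
      then obtain n where n: "measure M (\<Union>i. a i) - r / 2 < measure M (\<Union>i<n. a i)"
        by (auto simp: eventually_sequentially)
      obtain s where s: "measure M ((\<Union>i<n. a i) - val s \<union> (val s - (\<Union>i<n. a i))) < r / 2"
        using fin[of n] r unfolding appr_def by (meson half_gt_zero)
      have "measure M ((\<Union>i. a i) - val s \<union> (val s - (\<Union>i. a i)))
          \<le> measure M (((\<Union>i. a i) - (\<Union>i<n. a i)) \<union> ((\<Union>i<n. a i) - val s \<union> (val s - (\<Union>i<n. a i))))"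
        by (intro finite_measure_mono) auto
      also have "\<dots> \<le> measure M ((\<Union>i. a i) - (\<Union>i<n. a i)) + measure M ((\<Union>i<n. a i) - val s \<union> (val s - (\<Union>i<n. a i)))"
        by (intro measure_Un_le) auto
      also have "measure M ((\<Union>i. a i) - (\<Union>i<n. a i)) = measure M (\<Union>i. a i) - measure M (\<Union>i<n. a i)"
        by (intro finite_measure_Diff) auto
      finally show ?thesis
        using s n by (intro exI[of _ s]) linarith
    qed
    then show ?case by (simp add: appr_def)
  qed
  then have dense: "appr P" if "P \<in> sets M" for P
    using that unfolding G(1) by simp
  show thesis
  proof (rule that[of "\<lambda>k. val (from_nat k)"])
    fix P r assume "P \<in> sets M" "0 < (r::real)"
    then obtain s where "measure M (P - val s \<union> (val s - P)) < r"
      using dense unfolding appr_def by blast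
    then show "\<exists>k. measure M (P - val (from_nat k) \<union> (val (from_nat k) - P)) < r"
      by (intro exI[of _ "to_nat s"]) simp
  qed auto
qed


section \<open>Topology and measurability in lcsc groups\<close>

lemma lcsc_groupD:
  assumes "lcsc_group TYPE('g::{group_add,t2_space,second_countable_topology})"
  shows "continuous_on UNIV (\<lambda>p::'g \<times> 'g. fst p + snd p)" "continuous_on UNIV (uminus :: 'g \<Rightarrow> 'g)"
    "\<And>x::'g. \<exists>U K. open U \<and> compact K \<and> x \<in> U \<and> U \<subseteq> K"
    "\<And>(x::'g) O'. open O' \<Longrightarrow> x \<in> O' \<Longrightarrow> \<exists>U C. open U \<and> closed C \<and> x \<in> U \<and> U \<subseteq> C \<and> C \<subseteq> O'"
proof -
  from assms have lc: "locally_compact_space (euclidean :: 'g topology)"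
    by (simp add: lcsc_group_def)
  show "continuous_on UNIV (\<lambda>p::'g \<times> 'g. fst p + snd p)" "continuous_on UNIV (uminus :: 'g \<Rightarrow> 'g)"
    using assms by (simp_all add: lcsc_group_def)
  show "\<exists>U K. open U \<and> compact K \<and> x \<in> U \<and> U \<subseteq> K" for x :: 'g
    using lc unfolding locally_compact_space_def by (auto simp: compactin_euclidean_iff)
  \<comment> \<open>Regularity is what lets closures of basic open sets decide whether a limit lies
    in a given open set, in the measurability proof of the selector.\<close>
  have "regular_space (euclidean :: 'g topology)"
    using lc by (rule locally_compact_Hausdorff_imp_regular_space)
      (auto simp: Hausdorff_space_def disjnt_def dest!: hausdorff)
  then show "\<exists>U C. open U \<and> closed C \<and> x \<in> U \<and> U \<subseteq> C \<and> C \<subseteq> O'" if "open O'" "x \<in> O'" for x :: 'g and O'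
    using that unfolding neighbourhood_base_of_closedin[symmetric] neighbourhood_base_of
    by (simp add: closed_closedin[symmetric])
qed

lemma lcsc_group_continuous:
  assumes "lcsc_group TYPE('g::{group_add,t2_space,second_countable_topology})"
  shows "continuous_on S f \<Longrightarrow> continuous_on S g \<Longrightarrow> continuous_on S (\<lambda>x. f x + g x :: 'g)"
    "continuous_on S f \<Longrightarrow> continuous_on S (\<lambda>x. - f x :: 'g)"
  using continuous_on_compose2[OF lcsc_groupD(1)[OF assms], of S "\<lambda>x. (f x, g x)"]
    continuous_on_compose2[OF lcsc_groupD(2)[OF assms], of S f]
  by (auto intro!: continuous_on_Pair)

text \<open>Second countability identifies the Borel sigma algebra of the product with the product
  sigma algebra, so a continuous group law is jointly measurable.\<close>

lemma lcsc_group_measurable: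
  assumes "lcsc_group TYPE('g::{group_add,t2_space,second_countable_topology})"
  shows "f \<in> borel_measurable M \<Longrightarrow> g \<in> borel_measurable M \<Longrightarrow> (\<lambda>x. f x + g x :: 'g) \<in> borel_measurable M"
    "f \<in> borel_measurable M \<Longrightarrow> (\<lambda>x. - f x :: 'g) \<in> borel_measurable M"
proof -
  assume [measurable]: "f \<in> borel_measurable M"
  have "(\<lambda>x. (f x, g x)) \<in> borel_measurable M" if "g \<in> borel_measurable M" for g :: "'a \<Rightarrow> 'g"
    using that by (simp add: borel_prod[symmetric])
  from measurable_compose[OF this borel_measurable_continuous_onI[OF lcsc_groupD(1)[OF assms]]]
  show "g \<in> borel_measurable M \<Longrightarrow> (\<lambda>x. f x + g x) \<in> borel_measurable M"
    by simp
  show "(\<lambda>x. - f x) \<in> borel_measurable M"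
    using measurable_compose[OF \<open>f \<in> borel_measurable M\<close> borel_measurable_continuous_onI[OF lcsc_groupD(2)[OF assms]]] .
qed

lemma measurable_measure_section:
  fixes M :: "'a::topological_space measure"
  assumes "sigma_finite_measure M" "sets M = sets borel"
    and "Measurable.pred (N \<Otimes>\<^sub>M borel) (\<lambda>(x, y). Q x y)"
  shows "(\<lambda>x. emeasure M {y. Q x y}) \<in> borel_measurable N"
    "(\<lambda>x. measure M {y. Q x y}) \<in> borel_measurable N"
proof -
  interpret sigma_finite_measure M by fact
  have sp: "space M = UNIV"
    using sets_eq_imp_space_eq[OF assms(2)] by simp
  have "{x \<in> space (N \<Otimes>\<^sub>M borel). case_prod Q x} \<in> sets (N \<Otimes>\<^sub>M borel)"
    using assms(3) by (simp add: pred_def)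
  then have "{x \<in> space (N \<Otimes>\<^sub>M M). snd x \<in> {y. Q (fst x) y}} \<in> sets (N \<Otimes>\<^sub>M M)"
    by (simp add: space_pair_measure sp split_beta sets_pair_measure_cong[OF refl assms(2)])
  then show *: "(\<lambda>x. emeasure M {y. Q x y}) \<in> borel_measurable N"
    by (intro measurable_emeasure) (simp_all add: sp)
  show "(\<lambda>x. measure M {y. Q x y}) \<in> borel_measurable N"
    unfolding measure_def using * by measurable
qed

text \<open>In the proof, \<open>core n k E\<close> keeps those points of \<open>E\<close> whose value of \<open>F\<close> is \<open>V n\<close>-close to more
  than half of the values on \<open>E \<inter> A k\<close>. Any two such points share a close neighbour, so \<open>F\<close> oscillates
  little on the core; a non-null core exists because the \<open>A k\<close> are dense in the measure algebra. All
  choices depend only on the differences \<open>- F t h + F t h'\<close>, whence equivariance.\<close>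

lemma equivariant_selector:
  fixes F :: "'w \<Rightarrow> 'h::second_countable_topology \<Rightarrow> 'g::{group_add,t2_space,second_countable_topology}"
  assumes G: "lcsc_group TYPE('g)"
    and \<sigma>: "finite_measure \<sigma>" "sets \<sigma> = sets borel"
    and E0: "Measurable.pred (M \<Otimes>\<^sub>M borel) (\<lambda>(t, h). E0 t h)"
    and F: "(\<lambda>(t, h). F t h) \<in> borel_measurable (M \<Otimes>\<^sub>M borel)"
    and pos: "\<And>t. t \<in> space M \<Longrightarrow> emeasure \<sigma> {h. E0 t h} \<noteq> 0"
  obtains p where "p \<in> borel_measurable M"
    "\<And>t t' g. t \<in> space M \<Longrightarrow> t' \<in> space M \<Longrightarrow> (\<And>h. E0 t' h = E0 t h) \<Longrightarrow>
      (\<And>h. E0 t h \<Longrightarrow> F t' h = g + F t h) \<Longrightarrow> p t' = g + p t"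
proof -
  interpret finite_measure \<sigma> by fact
  note [measurable_cong] = \<sigma>(2)
  note [measurable (raw)] = lcsc_group_measurable[OF G]
  have sp: "space \<sigma> = UNIV"
    using sets_eq_imp_space_eq[OF \<sigma>(2)] by simp
  note E0 [measurable] F [measurable]
  note [measurable (raw)] = measurable_measure_section[OF sigma_finite_measure_axioms \<sigma>(2)]
  obtain B :: "'h set set" where B: "countable B" "topological_basis B"
    using ex_countable_basis by blast
  obtain A :: "nat \<Rightarrow> 'h set" where A: "range A \<subseteq> sets \<sigma>"
    "\<And>P r. P \<in> sets \<sigma> \<Longrightarrow> 0 < r \<Longrightarrow> \<exists>k. measure \<sigma> (P - A k \<union> (A k - P)) < r"
  proof (rule countable_dense_measure_algebra[OF \<sigma>(1), of B])
    show "sets \<sigma> = sigma_sets (space \<sigma>) B"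
      unfolding \<sigma>(2) borel_eq_countable_basis[OF B] sp by (rule sets_measure_of) auto
  qed (use B in auto)
  have [measurable]: "A k \<in> sets borel" for k
    using A(1) \<sigma>(2) by auto
  obtain V :: "nat \<Rightarrow> 'g set" where V: "\<And>i. open (V i)" "\<And>i. 0 \<in> V i"
    "\<And>S. open S \<Longrightarrow> 0 \<in> S \<Longrightarrow> \<forall>\<^sub>F i in sequentially. V i \<subseteq> S"
    using countable_basis_at_decseq[of "0::'g"] by metis
  have [measurable]: "V i \<in> sets borel" for i
    using V(1) by auto
  have cdiff: "continuous_on UNIV (\<lambda>p::'g \<times> 'g. fst p + - snd p)"
    by (intro lcsc_group_continuous[OF G] continuous_intros)
  have Vdiff: "\<forall>\<^sub>F i in sequentially. \<forall>a\<in>V i. \<forall>b\<in>V i. a + - b \<in> W" if W: "open W" "0 \<in> W" for W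
  proof -
    have "open ((\<lambda>p::'g \<times> 'g. fst p + - snd p) -` W)"
      using cdiff W(1) by (simp add: continuous_on_open_vimage)
    moreover have "(0, 0) \<in> (\<lambda>p::'g \<times> 'g. fst p + - snd p) -` W"
      using W(2) by simp
    ultimately obtain X Y where XY: "open X" "open Y" "(0, 0) \<in> X \<times> Y"
      "X \<times> Y \<subseteq> (\<lambda>p::'g \<times> 'g. fst p + - snd p) -` W"
      by (rule open_prod_elim)
    have "\<forall>\<^sub>F i in sequentially. V i \<subseteq> X" "\<forall>\<^sub>F i in sequentially. V i \<subseteq> Y"
      using XY(3) by (intro V(3) XY(1,2); simp)+
    then show ?thesis
    proof eventually_elim
      case (elim i)
      show ?case
      proof (intro ballI)
        fix a b assume "a \<in> V i" "b \<in> V i"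
        then have "(a, b) \<in> X \<times> Y" using elim by blast
        then have "(a, b) \<in> (\<lambda>p::'g \<times> 'g. fst p + - snd p) -` W" using XY(4) by blast
        then show "a + - b \<in> W" by simp
      qed
    qed
  qed

  define Z where "Z n k E t h = {h'. E t h' \<and> h' \<in> A k \<and> - F t h + F t h' \<in> V n}"
    for n k and E :: "'w \<Rightarrow> 'h \<Rightarrow> bool" and t h
  define core where "core n k E t h \<longleftrightarrow> E t h \<and>
      measure \<sigma> {h'. E t h' \<and> h' \<in> A k} / 2 < measure \<sigma> (Z n k E t h)"
    for n k and E :: "'w \<Rightarrow> 'h \<Rightarrow> bool" and t h
  \<comment> \<open>The least admissible k is a measurable choice, and one that sees
    \<open>F\<close> only through differences of its values.\<close>
  define idx where "idx n E t = (LEAST k. 0 < measure \<sigma> {h. core n k E t h})"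
    for n and E :: "'w \<Rightarrow> 'h \<Rightarrow> bool" and t
  define EE where "EE = rec_nat E0 (\<lambda>n E t h. core n (idx n E t) E t h)"
  have EE0: "EE 0 = E0" and EESuc: "EE (Suc n) t h \<longleftrightarrow> core n (idx n (EE n) t) (EE n) t h" for n t h
    by (simp_all add: EE_def)
  have EE_dec: "EE n t h" if "EE m t h" "n \<le> m" for n m t h
    using that(2,1) by (induction rule: inc_induct) (auto simp: EESuc core_def)

  have EE_measurable: "Measurable.pred (M \<Otimes>\<^sub>M borel) (\<lambda>(t, h). EE n t h)" for n
  proof (induction n)
    case 0
    then show ?case using E0 by (simp add: EE0)
  next
    case (Suc n)
    note Suc.IH [measurable]
    have [measurable]: "Measurable.pred (M \<Otimes>\<^sub>M borel) (\<lambda>(t, h). core n k (EE n) t h)" for k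
      unfolding core_def Z_def split_beta by measurable
    have [measurable]: "(\<lambda>t. idx n (EE n) t) \<in> M \<rightarrow>\<^sub>M count_space UNIV"
      unfolding idx_def by measurable
    \<comment> \<open>The index varies with t; splitting over its countably many values reduces to a
      fixed k.\<close>
    have "(\<lambda>(t, h). EE (Suc n) t h) = (\<lambda>x. \<exists>k. idx n (EE n) (fst x) = k \<and> core n k (EE n) (fst x) (snd x))"
      by (auto simp: EESuc)
    also have "Measurable.pred (M \<Otimes>\<^sub>M borel) \<dots>"
      by measurable
    finally show ?case .
  qed
  note EE_measurable [measurable]

  have EE_pos: "measure \<sigma> {h. EE n t h} > 0" if t: "t \<in> space M" for n t
  proof (induction n)
    case 0
    then show ?case
      using pos[OF t] measure_nonneg[of \<sigma> "{h. E0 t h}"] by (auto simp: EE0 emeasure_eq_measure less_le)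
  next
    case (Suc n)
    have [measurable]: "{h. EE n t h} \<in> sets borel"
      using t by measurable
    have Fb [measurable]: "(\<lambda>h. F t h) \<in> borel_measurable borel"
      using t by measurable
    \<comment> \<open>Open sets with all differences in \<open>V n\<close> cover the group, and
      countably many suffice. Hence \<open>F t\<close> stays in one of them on a non-null part of
      \<open>EE n t\<close>.\<close>
    have "\<exists>D::'g set set. countable D \<and> (\<forall>X\<in>D. open X \<and> (\<forall>a\<in>X. \<forall>b\<in>X. - a + b \<in> V n)) \<and> \<Union>D = UNIV"
    proof -
      have cd: "continuous_on UNIV (\<lambda>p::'g \<times> 'g. - fst p + snd p)"
        by (intro lcsc_group_continuous[OF G] continuous_intros)
      obtain T :: "'g set set" where T: "countable T" "topological_basis T"
        using ex_countable_basis by blast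
      let ?D = "{X \<in> T. \<forall>a\<in>X. \<forall>b\<in>X. - a + b \<in> V n}"
      have "x \<in> \<Union>?D" for x
      proof -
        have "open ((\<lambda>p::'g \<times> 'g. - fst p + snd p) -` V n)"
          using cd V(1) by (simp add: continuous_on_open_vimage)
        moreover have "(x, x) \<in> (\<lambda>p::'g \<times> 'g. - fst p + snd p) -` V n"
          using V(2) by simp
        ultimately obtain X Y where XY: "open X" "open Y" "(x, x) \<in> X \<times> Y"
          "X \<times> Y \<subseteq> (\<lambda>p::'g \<times> 'g. - fst p + snd p) -` V n"
          by (rule open_prod_elim)
        then have "open (X \<inter> Y)" "x \<in> X \<inter> Y" by auto
        then obtain U where U: "U \<in> T" "x \<in> U" "U \<subseteq> X \<inter> Y"
          using topological_basisE[OF T(2)] by metis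
        have "- a + b \<in> V n" if "a \<in> U" "b \<in> U" for a b
        proof -
          have "(a, b) \<in> X \<times> Y" using that U(3) by blast
          then have "(a, b) \<in> (\<lambda>p::'g \<times> 'g. - fst p + snd p) -` V n" using XY(4) by blast
          then show ?thesis by simp
        qed
        then show ?thesis
          using U by blast
      qed
      then show ?thesis
        using T topological_basis_open[OF T(2)] by (intro exI[of _ ?D]) auto
    qed
    then obtain D :: "'g set set" where D: "countable D" "\<And>X. X \<in> D \<Longrightarrow> open X"
      "\<And>X a b. X \<in> D \<Longrightarrow> a \<in> X \<Longrightarrow> b \<in> X \<Longrightarrow> - a + b \<in> V n" "\<Union>D = UNIV"
      by blast
    have "\<exists>X\<in>D. measure \<sigma> {h. EE n t h \<and> F t h \<in> X} > 0"
    proof (rule ccontr)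
      assume "\<not> ?thesis"
      then have "measure \<sigma> {h. EE n t h \<and> F t h \<in> X} = 0" if "X \<in> D" for X
        using that measure_nonneg[of \<sigma> "{h. EE n t h \<and> F t h \<in> X}"] by (metis less_le)
      moreover have "{h. EE n t h \<and> F t h \<in> X} \<in> sets \<sigma>" if "X \<in> D" for X
      proof -
        have [measurable]: "X \<in> sets borel" using D(2)[OF that] by simp
        show ?thesis unfolding \<sigma>(2) using t by measurable
      qed
      ultimately have "(\<Union>X\<in>D. {h. EE n t h \<and> F t h \<in> X}) \<in> null_sets \<sigma>"
        using D(1) by (intro null_sets_UN') (auto intro!: null_setsI simp: emeasure_eq_measure)
      also have "(\<Union>X\<in>D. {h. EE n t h \<and> F t h \<in> X}) = {h. EE n t h}"
        using D(4) by auto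
      finally show False
        using Suc.IH by (auto simp: null_sets_def emeasure_eq_measure)
    qed
    then obtain X where X: "X \<in> D" "measure \<sigma> {h. EE n t h \<and> F t h \<in> X} > 0"
      by blast
    have [measurable]: "X \<in> sets borel" using D(2)[OF X(1)] by simp
    define P where "P = {h. EE n t h \<and> F t h \<in> X}"
    have Pm [measurable]: "P \<in> sets \<sigma>"
      unfolding P_def \<sigma>(2) using t by measurable
    \<comment> \<open>With error below a quarter of the mass of \<open>P\<close>, more than three
      quarters of \<open>P\<close> lie in \<open>A k\<close> and less than one quarter of that mass
      is added by \<open>A k - P\<close>. So \<open>P\<close> fills more than half of the part of
      \<open>EE n t\<close> in \<open>A k\<close>, and \<open>P\<close> lies in the core.\<close>
    have "measure \<sigma> P / 4 > 0"
      using X(2) by (simp add: P_def)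
    then obtain k where k: "measure \<sigma> (P - A k \<union> (A k - P)) < measure \<sigma> P / 4"
      using A(2)[OF Pm] by meson
    have m1: "measure \<sigma> (P - A k) < measure \<sigma> P / 4" "measure \<sigma> (A k - P) < measure \<sigma> P / 4"
      using k finite_measure_mono[of "P - A k" "P - A k \<union> (A k - P)"]
        finite_measure_mono[of "A k - P" "P - A k \<union> (A k - P)"] by auto
    have m2: "measure \<sigma> P = measure \<sigma> (P \<inter> A k) + measure \<sigma> (P - A k)"
      using finite_measure_Diff'[of P "A k"] by auto
    have "{h'. EE n t h' \<and> h' \<in> A k} \<subseteq> (P \<inter> A k) \<union> (A k - P)"
      by auto
    then have "measure \<sigma> {h'. EE n t h' \<and> h' \<in> A k} \<le> measure \<sigma> ((P \<inter> A k) \<union> (A k - P))"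
      using Pm by (intro finite_measure_mono) auto
    also have "\<dots> \<le> measure \<sigma> (P \<inter> A k) + measure \<sigma> (A k - P)"
      by (intro measure_Un_le) auto
    finally have m3: "measure \<sigma> {h'. EE n t h' \<and> h' \<in> A k} / 2 < measure \<sigma> (P \<inter> A k)"
      using m1 m2 \<open>measure \<sigma> P / 4 > 0\<close> by linarith
    have "core n k (EE n) t h" if h: "h \<in> P" for h
    proof -
      have "Z n k (EE n) t h \<in> sets \<sigma>"
        unfolding \<sigma>(2) Z_def using t by measurable
      then have "measure \<sigma> (P \<inter> A k) \<le> measure \<sigma> (Z n k (EE n) t h)"
        using h D(3)[OF X(1)] by (intro finite_measure_mono) (auto simp: P_def Z_def)
      then show ?thesis
        using m3 h by (simp add: core_def P_def)
    qed
    then have PC: "P \<subseteq> {h. core n k (EE n) t h}" by auto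
    have "{h. core n k (EE n) t h} \<in> sets \<sigma>"
      unfolding \<sigma>(2) core_def Z_def using t by measurable
    then have "0 < measure \<sigma> {h. core n k (EE n) t h}"
      using finite_measure_mono[OF PC] \<open>measure \<sigma> P / 4 > 0\<close> by linarith
    then have "0 < measure \<sigma> {h. core n (idx n (EE n) t) (EE n) t h}"
      unfolding idx_def by (rule LeastI)
    then show ?case
      by (simp add: EESuc)
  qed

  have EE_diam: "\<exists>a\<in>V n. \<exists>b\<in>V n. - F t h1 + F t h2 = a + - b"
    if t: "t \<in> space M" and h: "EE (Suc n) t h1" "EE (Suc n) t h2" for n t h1 h2
  proof -
    define k where "k = idx n (EE n) t"
    let ?Y = "{h'. EE n t h' \<and> h' \<in> A k}"
    have Zm: "?Y \<in> sets \<sigma>" "Z n k (EE n) t h1 \<in> sets \<sigma>" "Z n k (EE n) t h2 \<in> sets \<sigma>"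
      unfolding \<sigma>(2) Z_def using t by measurable
    have "Z n k (EE n) t h1 \<inter> Z n k (EE n) t h2 \<noteq> {}"
    proof
      assume "Z n k (EE n) t h1 \<inter> Z n k (EE n) t h2 = {}"
      then have "measure \<sigma> (Z n k (EE n) t h1 \<union> Z n k (EE n) t h2)
          = measure \<sigma> (Z n k (EE n) t h1) + measure \<sigma> (Z n k (EE n) t h2)"
        using Zm by (intro finite_measure_Union) auto
      moreover have "measure \<sigma> (Z n k (EE n) t h1 \<union> Z n k (EE n) t h2) \<le> measure \<sigma> ?Y"
        using Zm by (intro finite_measure_mono) (auto simp: Z_def)
      ultimately show False
        using h unfolding EESuc core_def k_def by linarith
    qed
    then obtain h' where "- F t h1 + F t h' \<in> V n" "- F t h2 + F t h' \<in> V n"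
      by (auto simp: Z_def)
    moreover have "- F t h1 + F t h2 = (- F t h1 + F t h') + - (- F t h2 + F t h')"
      by (simp add: algebra_simps minus_add)
    ultimately show ?thesis by blast
  qed

  \<comment> \<open>A common cluster point of the sets of values; the shrinking oscillation turns it
    into a limit, hence makes it unique.\<close>
  define lim where "lim t y \<longleftrightarrow> (\<forall>U. open U \<longrightarrow> y \<in> U \<longrightarrow> (\<forall>n. \<exists>h. EE n t h \<and> F t h \<in> U))" for t y
  have EE_ex: "\<exists>h. EE n t h" if "t \<in> space M" for n t
  proof (rule ccontr)
    assume "\<not> ?thesis"
    then have "{h. EE n t h} = {}" by auto
    then show False using EE_pos[OF that, of n] by simp
  qed
  have lim_ev: "\<forall>\<^sub>F n in sequentially. \<forall>h. EE n t h \<longrightarrow> F t h \<in> U"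
    if t: "t \<in> space M" and y: "lim t y" and U: "open U" "y \<in> U" for t y U
  proof -
    have "open ((\<lambda>p::'g \<times> 'g. fst p + snd p) -` U)"
      using lcsc_groupD(1)[OF G] U(1) by (simp add: continuous_on_open_vimage)
    moreover have "(y, 0) \<in> (\<lambda>p::'g \<times> 'g. fst p + snd p) -` U"
      using U(2) by simp
    ultimately obtain X W where XW: "open X" "open W" "(y, 0) \<in> X \<times> W"
      "X \<times> W \<subseteq> (\<lambda>p::'g \<times> 'g. fst p + snd p) -` U"
      by (rule open_prod_elim)
    have "\<forall>\<^sub>F n in sequentially. \<forall>a\<in>V n. \<forall>b\<in>V n. a + - b \<in> W"
      using XW by (intro Vdiff) auto
    then have "\<forall>\<^sub>F n in sequentially. \<forall>h. EE (Suc n) t h \<longrightarrow> F t h \<in> U"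
    proof eventually_elim
      case (elim n)
      obtain h0 where h0: "EE (Suc n) t h0" "F t h0 \<in> X"
        using y XW unfolding lim_def by blast
      show ?case
      proof (intro allI impI)
        fix h assume "EE (Suc n) t h"
        then have "- F t h0 + F t h \<in> W"
          using EE_diam[OF t h0(1)] elim by metis
        then have "(F t h0, - F t h0 + F t h) \<in> X \<times> W"
          using h0 by simp
        then have "(F t h0, - F t h0 + F t h) \<in> (\<lambda>p::'g \<times> 'g. fst p + snd p) -` U"
          using XW(4) by blast
        then show "F t h \<in> U"
          by (simp add: add.assoc[symmetric])
      qed
    qed
    then show ?thesis
      by (subst (asm) eventually_sequentially_Suc)
  qed
  have lim_unique: "y = y'" if t: "t \<in> space M" and y: "lim t y" "lim t y'" for t y y'
  proof (rule ccontr)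
    assume "y \<noteq> y'"
    then obtain U U' where U: "open U" "open U'" "y \<in> U" "y' \<in> U'" "U \<inter> U' = {}"
      using hausdorff by metis
    have "\<forall>\<^sub>F n in sequentially. False"
      using lim_ev[OF t y(1) U(1,3)] lim_ev[OF t y(2) U(2,4)]
      by eventually_elim (use EE_ex[OF t] U(5) in blast)
    then show False by simp
  qed
  have lim_ex: "\<exists>y. lim t y" if t: "t \<in> space M" for t
  proof -
    \<comment> \<open>Once the oscillation lies in a relatively compact neighbourhood of 0, all
      later values lie in one compact translate. Compactness thus takes the place of completeness of
      the group.\<close>
    obtain U K where UK: "open U" "compact K" "(0::'g) \<in> U" "U \<subseteq> K"
      using lcsc_groupD(3)[OF G] by metis
    obtain N where N: "\<forall>a\<in>V N. \<forall>b\<in>V N. a + - b \<in> U"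
      using Vdiff[OF UK(1,3)] by (auto simp: eventually_sequentially)
    obtain h0 where h0: "EE (Suc N) t h0"
      using EE_ex[OF t] by blast
    have "continuous_on K ((+) (F t h0))"
      by (intro lcsc_group_continuous[OF G] continuous_intros)
    then have comp: "compact ((+) (F t h0) ` K)"
      using UK(2) by (rule compact_continuous_image)
    have in_comp: "F t h \<in> (+) (F t h0) ` K" if "EE (Suc N) t h" for h
    proof -
      have "- F t h0 + F t h \<in> K"
        using EE_diam[OF t h0 that] N UK(4) by (metis subsetD)
      then show ?thesis
        by (rule rev_image_eqI) (simp add: add.assoc[symmetric])
    qed
    have "((+) (F t h0) ` K) \<inter> (\<Inter>n\<in>UNIV. closure (F t ` {h. EE n t h})) \<noteq> {}"
    proof (rule compact_imp_fip_image[OF comp])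
      fix I' :: "nat set" assume I': "finite I'"
      define m where "m = Max (insert (Suc N) I')"
      have m: "Suc N \<le> m" "\<And>i. i \<in> I' \<Longrightarrow> i \<le> m"
        using I' by (auto simp: m_def)
      obtain h where "EE m t h"
        using EE_ex[OF t] by blast
      then have "F t h \<in> (+) (F t h0) ` K" "\<And>i. i \<in> I' \<Longrightarrow> F t h \<in> F t ` {h. EE i t h}"
        using EE_dec m in_comp by blast+
      then show "((+) (F t h0) ` K) \<inter> (\<Inter>n\<in>I'. closure (F t ` {h. EE n t h})) \<noteq> {}"
        using closure_subset by blast
    qed auto
    then obtain y where y: "\<And>n. y \<in> closure (F t ` {h. EE n t h})"
      by blast
    have "lim t y"
      unfolding lim_def
    proof (intro allI impI)
      fix U n assume "open U" "y \<in> U"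
      then have "U \<inter> F t ` {h. EE n t h} \<noteq> {}"
        using y[of n] open_Int_closure_eq_empty by fastforce
      then show "\<exists>h. EE n t h \<and> F t h \<in> U" by auto
    qed
    then show ?thesis ..
  qed
  define p where "p t = (THE y. lim t y)" for t
  have lim_p: "lim t (p t)" if "t \<in> space M" for t
    unfolding p_def by (rule theI') (use lim_ex[OF that] lim_unique[OF that] in blast)
  obtain T :: "'g set set" where T: "countable T" "topological_basis T"
    using ex_countable_basis by blast
  \<comment> \<open>Membership in an open set becomes a countable condition on measures of sections.
    Asking for a non-null set of h, instead of a single h, avoids projections of Borel sets.\<close>
  have p_open: "p t \<in> S \<longleftrightarrow> (\<exists>X\<in>{X\<in>T. closure X \<subseteq> S}. \<forall>n. 0 < emeasure \<sigma> {h. EE n t h \<and> F t h \<in> X})"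
    if t: "t \<in> space M" and S: "open S" for t S
  proof
    assume "p t \<in> S"
    then obtain U C where UC: "open U" "closed C" "p t \<in> U" "U \<subseteq> C" "C \<subseteq> S"
      using lcsc_groupD(4)[OF G S] by metis
    obtain X where X: "X \<in> T" "p t \<in> X" "X \<subseteq> U"
      by (rule topological_basisE[OF T(2) UC(1,3)])
    have "closure X \<subseteq> S"
      using X UC closure_minimal[of X C] by blast
    moreover have "0 < emeasure \<sigma> {h. EE n t h \<and> F t h \<in> X}" for n
    proof -
      have oX: "open X" using topological_basis_open[OF T(2) X(1)] .
      then have [measurable]: "X \<in> sets borel" by simp
      obtain m where m: "\<And>i h. m \<le> i \<Longrightarrow> EE i t h \<Longrightarrow> F t h \<in> X"
        using lim_ev[OF t lim_p[OF t] oX X(2)] by (auto simp: eventually_sequentially)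
      have "{h. EE n t h \<and> F t h \<in> X} \<in> sets \<sigma>"
        unfolding \<sigma>(2) using t by measurable
      then have "measure \<sigma> {h. EE (max m n) t h} \<le> measure \<sigma> {h. EE n t h \<and> F t h \<in> X}"
        by (intro finite_measure_mono) (auto intro: EE_dec m[of "max m n"])
      then show ?thesis
        using EE_pos[OF t, of "max m n"] by (simp add: emeasure_eq_measure)
    qed
    ultimately show "\<exists>X\<in>{X\<in>T. closure X \<subseteq> S}. \<forall>n. 0 < emeasure \<sigma> {h. EE n t h \<and> F t h \<in> X}"
      using X(1) by blast
  next
    assume "\<exists>X\<in>{X\<in>T. closure X \<subseteq> S}. \<forall>n. 0 < emeasure \<sigma> {h. EE n t h \<and> F t h \<in> X}"
    then obtain X where X: "closure X \<subseteq> S" "\<And>n. 0 < emeasure \<sigma> {h. EE n t h \<and> F t h \<in> X}"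
      by blast
    have "p t \<in> closure X"
    proof (rule ccontr)
      assume "p t \<notin> closure X"
      then have "\<forall>\<^sub>F n in sequentially. \<forall>h. EE n t h \<longrightarrow> F t h \<in> - closure X"
        by (intro lim_ev[OF t lim_p[OF t]]) auto
      then obtain n where n: "\<And>h. EE n t h \<Longrightarrow> F t h \<notin> closure X"
        by (auto simp: eventually_sequentially)
      then have "{h. EE n t h \<and> F t h \<in> X} = {}"
        using closure_subset by blast
      then show False
        using X(2)[of n] by (metis emeasure_empty less_irrefl)
    qed
    then show "p t \<in> S" using X(1) by blast
  qed
  show thesis
  proof (rule that)
    show "p \<in> borel_measurable M"
    proof (rule borel_measurableI)
      fix S :: "'g set" assume S: "open S"
      have cT: "countable {X\<in>T. closure X \<subseteq> S}"
        using T(1) by simp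
      have "Measurable.pred M (\<lambda>t. 0 < emeasure \<sigma> {h. EE n t h \<and> F t h \<in> X})" if "X \<in> T" for n X
      proof -
        have [measurable]: "X \<in> sets borel"
          using topological_basis_open[OF T(2) that] by simp
        show ?thesis by measurable
      qed
      then have "(\<Union>X\<in>{X\<in>T. closure X \<subseteq> S}. {t \<in> space M. \<forall>n. 0 < emeasure \<sigma> {h. EE n t h \<and> F t h \<in> X}}) \<in> sets M"
        using cT by (intro sets.countable_UN') (auto simp: pred_def)
      moreover have "p -` S \<inter> space M = (\<Union>X\<in>{X\<in>T. closure X \<subseteq> S}. {t \<in> space M. \<forall>n. 0 < emeasure \<sigma> {h. EE n t h \<and> F t h \<in> X}})"
        using p_open[OF _ S] by blast
      ultimately show "p -` S \<inter> space M \<in> sets M"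
        by simp
    qed
    fix t t' g assume t: "t \<in> space M" "t' \<in> space M" and eqE: "\<And>h. E0 t' h = E0 t h"
      and eqF: "\<And>h. E0 t h \<Longrightarrow> F t' h = g + F t h"
    have "EE n t' h = EE n t h" for n h
    proof (induction n arbitrary: h)
      case 0
      show ?case by (simp add: EE0 eqE)
    next
      case (Suc n)
      have cancel: "- F t' h + F t' h' = - F t h + F t h'" if "EE n t h" "EE n t h'" for h h'
        using eqF[of h] eqF[of h'] EE_dec[OF that(1), of 0] EE_dec[OF that(2), of 0]
        by (simp add: EE0 minus_add add.assoc[symmetric])
      have "core n k (EE n) t' h = core n k (EE n) t h" for k h
      proof -
        have "EE n t h \<Longrightarrow> Z n k (EE n) t' h = Z n k (EE n) t h"
          using cancel[of h] by (auto simp: Z_def Suc.IH)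
        then show ?thesis
          by (auto simp: core_def Suc.IH)
      qed
      then show ?case
        by (simp add: EESuc idx_def)
    qed
    note EE_eq = this
    have "lim t' (g + p t)"
      unfolding lim_def
    proof (intro allI impI)
      fix U n assume U: "open U" "g + p t \<in> U"
      have "continuous_on UNIV ((+) g)"
        by (intro lcsc_group_continuous[OF G] continuous_intros)
      then have "open ((+) g -` U)"
        using U(1) by (simp add: continuous_on_open_vimage)
      then obtain h where "EE n t h" "F t h \<in> (+) g -` U"
        using lim_p[OF t(1)] U(2) unfolding lim_def by (metis vimageI)
      then show "\<exists>h. EE n t' h \<and> F t' h \<in> U"
        using EE_eq eqF EE_dec[of n t h 0] by (auto simp: EE0 intro!: exI[of _ h])
    qed
    then show "p t' = g + p t"
      using lim_unique[OF t(2) lim_p[OF t(2)]] by blast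
  qed
qed

section \<open>Measure preserving actions\<close>

lemma haar_sigma_finite:
  fixes m :: "'g::{group_add,t2_space,second_countable_topology} measure"
  assumes "lcsc_group TYPE('g)" "haar_measure m"
  shows "sigma_finite_measure m"
proof
  have m: "sets m = sets borel" "\<And>K. compact K \<Longrightarrow> emeasure m K < \<infinity>"
    using assms(2) by (auto simp: haar_measure_def)
  obtain B :: "'g set set" where B: "countable B" "topological_basis B"
    using ex_countable_basis by blast
  let ?A = "{X \<in> B. emeasure m X \<noteq> \<infinity>}"
  have "x \<in> \<Union>?A" for x
  proof -
    obtain U K where UK: "open U" "compact K" "x \<in> U" "U \<subseteq> K"
      using lcsc_groupD(3)[OF assms(1)] by metis
    obtain X where X: "X \<in> B" "x \<in> X" "X \<subseteq> U"
      using UK(1,3) by (rule topological_basisE[OF B(2)])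
    have "K \<in> sets m"
      using compact_imp_closed[OF UK(2)] m(1) by simp
    then have "emeasure m X \<le> emeasure m K"
      using X(3) UK(4) by (intro emeasure_mono) auto
    then have "emeasure m X \<noteq> \<infinity>"
      using m(2)[OF UK(2)] by auto
    then show ?thesis
      using X by blast
  qed
  then have "\<Union>?A = space m"
    using sets_eq_imp_space_eq[OF m(1)] by auto
  moreover have "?A \<subseteq> sets m"
    using topological_basis_open[OF B(2)] m(1) by auto
  ultimately show "\<exists>A. countable A \<and> A \<subseteq> sets m \<and> \<Union> A = space m \<and> (\<forall>a\<in>A. emeasure m a \<noteq> \<infinity>)"
    using B(1) by (intro exI[of _ ?A]) auto
qed

lemma haar_compact_pos:
  fixes m :: "'g::{group_add,t2_space,second_countable_topology} measure"
  assumes "lcsc_group TYPE('g)" "haar_measure m"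
  obtains K where "K \<in> sets borel" "0 < emeasure m K" "emeasure m K < \<infinity>"
proof -
  obtain U K where UK: "open U" "compact K" "(0::'g) \<in> U" "U \<subseteq> K"
    using lcsc_groupD(3)[OF assms(1)] by metis
  have K: "K \<in> sets borel"
    using compact_imp_closed[OF UK(2)] by simp
  have "0 < emeasure m U"
    using assms(2) UK(1,3) unfolding haar_measure_def by blast
  also have "\<dots> \<le> emeasure m K"
    using K assms(2) UK(4) by (intro emeasure_mono) (auto simp: haar_measure_def)
  finally show thesis
    using that[OF K] UK(2) assms(2) by (auto simp: haar_measure_def)
qed

lemma standard_borel_singleton:
  assumes "standard_borel M" "x \<in> space M"
  shows "{x} \<in> sets M"
proof -
  have "space M \<noteq> {}" using assms(2) by auto
  then obtain e :: "'a \<Rightarrow> real" and e' where e: "e \<in> borel_measurable M" "\<And>y. y \<in> space M \<Longrightarrow> e' (e y) = y"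
    using standard_borel_real_embedding[OF assms(1)] by metis
  have "y = x" if "y \<in> space M" "e y = e x" for y
    using e(2)[OF that(1)] e(2)[OF assms(2)] that(2) by metis
  then have "{x} = {y \<in> space M. e y = e x}"
    using assms(2) by blast
  also have "\<dots> \<in> sets M"
    using e(1) by measurable
  finally show ?thesis .
qed

lemma standard_borel_atoms:
  assumes "standard_borel M" "finite_measure M"
  shows "{x \<in> space M. emeasure M {x} = 0} \<in> sets M"
proof -
  interpret finite_measure M by fact
  let ?D = "{x \<in> space M. measure M {x} \<noteq> 0}"
  have "?D \<subseteq> {x. measure M {x} \<noteq> 0}"
    by (simp add: subset_eq)
  then have "countable ?D"
    by (rule countable_subset[OF _ countable_support])
  moreover have "{x} \<in> sets M" if "x \<in> ?D" for x
    using that by (intro standard_borel_singleton assms(1)) simp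
  ultimately have "?D \<in> sets M"
    by (rule sets.countable[rotated])
  then have "space M - ?D \<in> sets M"
    by auto
  also have "space M - ?D = {x \<in> space M. emeasure M {x} = 0}"
    by (auto simp: emeasure_eq_measure)
  finally show ?thesis .
qed

lemma emeasure_pair_restrict_space:
  assumes "finite_measure N" "Y \<in> sets N" "S \<in> sets (M \<Otimes>\<^sub>M N)" "S \<subseteq> space M \<times> Y"
  shows "emeasure (M \<Otimes>\<^sub>M restrict_space N Y) S = emeasure (M \<Otimes>\<^sub>M N) S"
proof -
  interpret finite_measure N by fact
  interpret R: finite_measure "restrict_space N Y"
    by (rule finite_measure_restrict_space) (use assms in auto)
  have Y: "Y \<subseteq> space N"
    using assms(2) by (rule sets.sets_into_space)
  have "(\<lambda>p. (fst p, snd p)) \<in> M \<Otimes>\<^sub>M restrict_space N Y \<rightarrow>\<^sub>M M \<Otimes>\<^sub>M N"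
    by (intro measurable_Pair measurable_fst
        measurable_compose[OF measurable_snd measurable_restrict_space1[OF measurable_ident_sets[OF refl]]])
  from measurable_sets[OF this assms(3)]
  have "{p \<in> space (M \<Otimes>\<^sub>M restrict_space N Y). p \<in> S} \<in> sets (M \<Otimes>\<^sub>M restrict_space N Y)"
    by (simp add: vimage_def Int_def conj_commute)
  also have "{p \<in> space (M \<Otimes>\<^sub>M restrict_space N Y). p \<in> S} = S"
    using assms(4) Y by (auto simp: space_pair_measure space_restrict_space)
  finally have S: "S \<in> sets (M \<Otimes>\<^sub>M restrict_space N Y)" .
  have "emeasure (M \<Otimes>\<^sub>M restrict_space N Y) S = (\<integral>\<^sup>+x. emeasure (restrict_space N Y) (Pair x -` S) \<partial>M)"
    by (rule R.emeasure_pair_measure_alt[OF S])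
  also have "\<dots> = (\<integral>\<^sup>+x. emeasure N (Pair x -` S) \<partial>M)"
    by (intro nn_integral_cong emeasure_restrict_space) (use assms(2,4) in auto)
  also have "\<dots> = emeasure (M \<Otimes>\<^sub>M N) S"
    by (rule emeasure_pair_measure_alt[OF assms(3), symmetric])
  finally show ?thesis .
qed

section \<open>Invariant conull sets of a measure preserving action\<close>

locale measurable_action =
  fixes act :: "'g::{group_add,t2_space,second_countable_topology} \<Rightarrow>
      'h::{group_add,t2_space,second_countable_topology} \<Rightarrow> 'w \<Rightarrow> 'w" and \<eta> :: "'w measure"
  assumes mp: "mp_action act borel borel \<eta>"
begin

lemma act_measurable [measurable (raw)]:
  assumes "a \<in> borel_measurable N" "b \<in> borel_measurable N" "c \<in> N \<rightarrow>\<^sub>M \<eta>"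
  shows "(\<lambda>x. act (a x) (b x) (c x)) \<in> N \<rightarrow>\<^sub>M \<eta>"
proof -
  have *: "(\<lambda>(g, h, t). act g h t) \<in> borel \<Otimes>\<^sub>M borel \<Otimes>\<^sub>M \<eta> \<rightarrow>\<^sub>M \<eta>"
    using mp by (simp add: mp_action_def)
  have "(\<lambda>x. (a x, b x, c x)) \<in> N \<rightarrow>\<^sub>M borel \<Otimes>\<^sub>M borel \<Otimes>\<^sub>M \<eta>"
    using assms by (intro measurable_Pair)
  from measurable_compose[OF this *] show ?thesis
    by simp
qed

lemma act_space: "t \<in> space \<eta> \<Longrightarrow> act g h t \<in> space \<eta>"
  using measurable_space[OF act_measurable[of "\<lambda>_. g" \<eta> "\<lambda>_. h" "\<lambda>t. t"], of t] by simp

lemma act_zero: "t \<in> space \<eta> \<Longrightarrow> act 0 0 t = t"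
  using mp by (simp add: mp_action_def)

lemma act_act: "t \<in> space \<eta> \<Longrightarrow> act g h (act g' h' t) = act (g + g') (h + h') t"
  using mp by (simp add: mp_action_def)

lemma act_inverse: "t \<in> space \<eta> \<Longrightarrow> act (- g) (- h) (act g h t) = t"
  by (simp add: act_act act_zero)

lemma emeasure_act:
  assumes "Z \<in> sets \<eta>"
  shows "emeasure \<eta> {t \<in> space \<eta>. act g h t \<in> Z} = emeasure \<eta> Z"
proof -
  have "(\<lambda>t. act g h t) \<in> \<eta> \<rightarrow>\<^sub>M \<eta>" by measurable
  then have "emeasure (distr \<eta> \<eta> (act g h)) Z = emeasure \<eta> (act g h -` Z \<inter> space \<eta>)"
    using assms by (intro emeasure_distr) auto
  moreover have "distr \<eta> \<eta> (act g h) = \<eta>"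
    using mp by (simp add: mp_action_def)
  ultimately show ?thesis
    by (simp add: vimage_def Int_def conj_commute)
qed

definition invariant :: "'w set \<Rightarrow> bool" where
  "invariant W \<longleftrightarrow> W \<in> sets \<eta> \<and> emeasure \<eta> (space \<eta> - W) = 0 \<and> (\<forall>g h. \<forall>t\<in>W. act g h t \<in> W)"

lemma invariantD:
  assumes "invariant W"
  shows "W \<in> sets \<eta>" "W \<subseteq> space \<eta>" "emeasure \<eta> (space \<eta> - W) = 0" "\<And>g h t. t \<in> W \<Longrightarrow> act g h t \<in> W"
  using assms sets.sets_into_space by (auto simp: invariant_def)

lemma invariant_iff:
  assumes "invariant W" "t \<in> space \<eta>"
  shows "act g h t \<in> W \<longleftrightarrow> t \<in> W"
  using invariantD(4)[OF assms(1), of t g h] invariantD(4)[OF assms(1), of "act g h t" "- g" "- h"]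
    act_inverse[OF assms(2)] by auto

lemma invariant_Int:
  assumes "invariant V" "invariant W"
  shows "invariant (V \<inter> W)"
proof -
  note V = invariantD[OF assms(1)] and W = invariantD[OF assms(2)]
  have "(space \<eta> - V) \<union> (space \<eta> - W) \<in> null_sets \<eta>"
    using V W by (intro null_sets.Un) (auto intro!: null_setsI)
  moreover have "(space \<eta> - V) \<union> (space \<eta> - W) = space \<eta> - V \<inter> W"
    by auto
  ultimately show ?thesis
    using V W by (auto simp: invariant_def)
qed

lemma mp_action_restrict:
  assumes "invariant W"
  shows "mp_action act borel borel (restrict_space \<eta> W)"
proof -
  note W = invariantD[OF assms]
  have sp: "space (restrict_space \<eta> W) = W"
    using W(2) by (auto simp: space_restrict_space)
  have "(\<lambda>x. act (fst x) (fst (snd x)) (snd (snd x))) \<in> borel \<Otimes>\<^sub>M borel \<Otimes>\<^sub>M restrict_space \<eta> W \<rightarrow>\<^sub>M restrict_space \<eta> W"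
  proof (rule measurable_restrict_space2)
    show "(\<lambda>x. act (fst x) (fst (snd x)) (snd (snd x))) \<in> space (borel \<Otimes>\<^sub>M borel \<Otimes>\<^sub>M restrict_space \<eta> W) \<rightarrow> W"
      using W(4) by (auto simp: space_pair_measure sp)
    have "(\<lambda>t. t) \<in> restrict_space \<eta> W \<rightarrow>\<^sub>M \<eta>"
      by (intro measurable_restrict_space1 measurable_ident_sets refl)
    from measurable_compose[OF measurable_compose[OF measurable_snd measurable_snd] this]
    show "(\<lambda>x. act (fst x) (fst (snd x)) (snd (snd x))) \<in> borel \<Otimes>\<^sub>M borel \<Otimes>\<^sub>M restrict_space \<eta> W \<rightarrow>\<^sub>M \<eta>"
      by (intro act_measurable) auto
  qed
  moreover have "distr (restrict_space \<eta> W) (restrict_space \<eta> W) (act g h) = restrict_space \<eta> W" for g h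
  proof (rule measure_eqI)
    fix Z assume "Z \<in> sets (distr (restrict_space \<eta> W) (restrict_space \<eta> W) (act g h))"
    then have Z: "Z \<in> sets \<eta>" "Z \<subseteq> W"
      using W(1,2) by (auto simp: sets_restrict_space_iff)
    have m: "act g h \<in> restrict_space \<eta> W \<rightarrow>\<^sub>M restrict_space \<eta> W"
      by (intro measurable_restrict_space2 measurable_restrict_space1) (use W(4) sp in auto)
    have "emeasure (distr (restrict_space \<eta> W) (restrict_space \<eta> W) (act g h)) Z
        = emeasure (restrict_space \<eta> W) (act g h -` Z \<inter> W)"
      using m Z W(1,2) sp by (subst emeasure_distr) (auto simp: sets_restrict_space_iff)
    also have "\<dots> = emeasure \<eta> (act g h -` Z \<inter> W)"
      using W(1) by (intro emeasure_restrict_space) auto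
    \<comment> \<open>A point carried into \<open>W\<close> was already in \<open>W\<close>, so
      restricting the action loses no preimages.\<close>
    also have "act g h -` Z \<inter> W = {t \<in> space \<eta>. act g h t \<in> Z}"
      using invariant_iff[OF assms] Z(2) W(2) by blast
    also have "emeasure \<eta> \<dots> = emeasure \<eta> Z"
      by (rule emeasure_act) fact
    also have "\<dots> = emeasure (restrict_space \<eta> W) Z"
      using W(1) Z by (intro emeasure_restrict_space[symmetric]) auto
    finally show "emeasure (distr (restrict_space \<eta> W) (restrict_space \<eta> W) (act g h)) Z = emeasure (restrict_space \<eta> W) Z" .
  qed simp
  ultimately show ?thesis
    using W by (auto simp: mp_action_def split_beta' sp act_zero act_act subset_eq)
qed

end

section \<open>Fundamental domains\<close>

text \<open>One half of a coupling in coordinates: \<open>p\<close> and \<open>q\<close> are total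
  Borel extensions of the components of the inverse of \<open>i\<close> on \<open>B\<close>, and
  \<open>emeasure_i\<close> is measure preservation. It is stated for one factor, so that swapping
  the groups gives the other half.\<close>

locale fundamental_domain = measurable_action act \<eta>
  for act :: "'g::{group_add,t2_space,second_countable_topology} \<Rightarrow>
      'h::{group_add,t2_space,second_countable_topology} \<Rightarrow> 'w \<Rightarrow> 'w" and \<eta> :: "'w measure" +
  fixes lamG :: "'g measure" and lamH :: "'h measure" and \<nu> :: "'y measure"
    and i :: "'g \<times> 'y \<Rightarrow> 'w" and p :: "'w \<Rightarrow> 'g" and q :: "'w \<Rightarrow> 'y" and Y B
  assumes G: "lcsc_group TYPE('g)" and H: "lcsc_group TYPE('h)"
    and haarG: "unimodular_haar lamG" and haarH: "unimodular_haar lamH"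
    and borel_\<eta>: "standard_borel \<eta>" and \<eta>_nonzero: "emeasure \<eta> (space \<eta>) \<noteq> 0"
    and borel_\<nu>: "standard_borel \<nu>" and finite_\<nu>: "finite_measure \<nu>"
    and Y_sets [measurable]: "Y \<in> sets \<nu>" and Y_conull: "emeasure \<nu> (space \<nu> - Y) = 0"
    and B_sets [measurable]: "B \<in> sets \<eta>" and B_conull: "emeasure \<eta> (space \<eta> - B) = 0"
    and B_act: "\<And>g t. t \<in> B \<Longrightarrow> act g 0 t \<in> B"
    and p_measurable [measurable]: "p \<in> borel_measurable \<eta>"
    and q_measurable [measurable]: "q \<in> \<eta> \<rightarrow>\<^sub>M \<nu>"
    and i_measurable [measurable]: "i \<in> lamG \<Otimes>\<^sub>M \<nu> \<rightarrow>\<^sub>M \<eta>"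
    and i_pq: "\<And>t. t \<in> B \<Longrightarrow> q t \<in> Y \<and> i (p t, q t) = t"
    and pq_i: "\<And>g y. y \<in> Y \<Longrightarrow> i (g, y) \<in> B \<and> p (i (g, y)) = g \<and> q (i (g, y)) = y"
    and i_act: "\<And>g g' y. y \<in> Y \<Longrightarrow> i (g + g', y) = act g 0 (i (g', y))"
    and emeasure_i: "\<And>Z. Z \<in> sets \<eta> \<Longrightarrow> Z \<subseteq> B \<Longrightarrow>
      emeasure \<eta> Z = emeasure (lamG \<Otimes>\<^sub>M \<nu>) {x \<in> UNIV \<times> Y. i x \<in> Z}"
begin

sublocale \<nu>: finite_measure \<nu>
  by (rule finite_\<nu>)

sublocale lamG: sigma_finite_measure lamG
  using haarG by (intro haar_sigma_finite[OF G]) (simp add: unimodular_haar_def)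

sublocale lamH: sigma_finite_measure lamH
  using haarH by (intro haar_sigma_finite[OF H]) (simp add: unimodular_haar_def)

lemma sets_lam [simp, measurable_cong]: "sets lamG = sets borel" "sets lamH = sets borel"
  using haarG haarH by (auto simp: unimodular_haar_def haar_measure_def)

lemma space_lam [simp]: "space lamG = UNIV" "space lamH = UNIV"
  using sets_eq_imp_space_eq[OF sets_lam(1)] sets_eq_imp_space_eq[OF sets_lam(2)] by auto

lemma lamG_UNIV: "emeasure lamG UNIV \<noteq> 0"
  using haarG unfolding unimodular_haar_def haar_measure_def by (metis UNIV_not_empty less_irrefl open_UNIV)

lemmas group_measurable [measurable (raw)] = lcsc_group_measurable[OF G] lcsc_group_measurable[OF H]

lemma B_space: "B \<subseteq> space \<eta>"
  by (rule sets.sets_into_space) (rule B_sets)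

lemma Y_space: "Y \<subseteq> space \<nu>"
  by (rule sets.sets_into_space) (rule Y_sets)

lemma B_act_iff: "t \<in> space \<eta> \<Longrightarrow> act g 0 t \<in> B \<longleftrightarrow> t \<in> B"
  using B_act[of t g] B_act[of "act g 0 t" "- g"] act_inverse[of t g 0] by auto

lemma pq_act:
  assumes "t \<in> B"
  shows "p (act g 0 t) = g + p t" "q (act g 0 t) = q t"
proof -
  have "act g 0 t = i (g + p t, q t)"
    using i_pq[OF assms] i_act[of "q t" g "p t"] by simp
  then show "p (act g 0 t) = g + p t" "q (act g 0 t) = q t"
    using pq_i[of "q t"] i_pq[OF assms] by simp_all
qed

lemma i_zero_measurable [measurable]: "(\<lambda>y. i (0, y)) \<in> \<nu> \<rightarrow>\<^sub>M \<eta>"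
  by measurable

lemma i_eq_act: "y \<in> Y \<Longrightarrow> i (g, y) = act g 0 (i (0, y))"
  using i_act[of y g 0] by simp

lemma act_p_i_q: "t \<in> B \<Longrightarrow> act (- p t) 0 t = i (0, q t)"
  using i_pq[of t] i_act[of "q t" "- p t" "p t"] by simp

lemma emeasure_strip:
  assumes "D \<in> sets \<nu>" "D \<subseteq> Y"
  shows "emeasure \<eta> {t \<in> B. q t \<in> D} = emeasure lamG UNIV * emeasure \<nu> D"
proof -
  have "{t \<in> B. q t \<in> D} = {t \<in> space \<eta>. t \<in> B \<and> q t \<in> D}"
    using B_space by auto
  also have "\<dots> \<in> sets \<eta>"
    using assms(1) by measurable
  finally have "emeasure \<eta> {t \<in> B. q t \<in> D} = emeasure (lamG \<Otimes>\<^sub>M \<nu>) {x \<in> UNIV \<times> Y. i x \<in> {t \<in> B. q t \<in> D}}"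
    by (rule emeasure_i) auto
  also have "{x \<in> UNIV \<times> Y. i x \<in> {t \<in> B. q t \<in> D}} = UNIV \<times> D"
    using pq_i assms(2) by auto
  also have "emeasure (lamG \<Otimes>\<^sub>M \<nu>) (UNIV \<times> D) = emeasure lamG UNIV * emeasure \<nu> D"
    using assms(1) by (intro \<nu>.emeasure_pair_measure_Times) auto
  finally show ?thesis .
qed

text \<open>The total mass of G may be infinite but is not zero, so null sets of parameters
  correspond exactly to null unions of orbits.\<close>

lemma strip_null_iff:
  assumes "D \<in> sets \<nu>" "D \<subseteq> Y"
  shows "emeasure \<eta> {t \<in> B. q t \<in> D} = 0 \<longleftrightarrow> emeasure \<nu> D = 0"
  using emeasure_strip[OF assms] lamG_UNIV by simp

text \<open>The measure on the coupling may be infinite. Pulling back sets of finite Haar measure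
  along \<open>p\<close> gives pieces of finite measure, as Fubini needs in
  \<open>generic_invariant\<close>.\<close>

lemma sigma_finite_\<eta>: "sigma_finite_measure \<eta>"
proof
  obtain A where A: "countable A" "A \<subseteq> sets lamG" "\<Union>A = space lamG" "\<And>a. a \<in> A \<Longrightarrow> emeasure lamG a \<noteq> \<infinity>"
    using lamG.sigma_finite_countable by blast
  let ?S = "insert (space \<eta> - B) ((\<lambda>a. {t \<in> B. p t \<in> a}) ` A)"
  have S: "{t \<in> B. p t \<in> a} \<in> sets \<eta> \<and> emeasure \<eta> {t \<in> B. p t \<in> a} \<noteq> \<infinity>" if "a \<in> A" for a
  proof
    have a: "a \<in> sets borel"
      using that A(2) by auto
    have "{t \<in> B. p t \<in> a} = {t \<in> space \<eta>. t \<in> B \<and> p t \<in> a}"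
      using B_space by auto
    also have "\<dots> \<in> sets \<eta>"
      using a by measurable
    finally show m: "{t \<in> B. p t \<in> a} \<in> sets \<eta>" .
    then have "emeasure \<eta> {t \<in> B. p t \<in> a} = emeasure (lamG \<Otimes>\<^sub>M \<nu>) {x \<in> UNIV \<times> Y. i x \<in> {t \<in> B. p t \<in> a}}"
      by (rule emeasure_i) auto
    also have "{x \<in> UNIV \<times> Y. i x \<in> {t \<in> B. p t \<in> a}} = a \<times> Y"
      using pq_i by auto
    also have "emeasure (lamG \<Otimes>\<^sub>M \<nu>) (a \<times> Y) = emeasure lamG a * emeasure \<nu> Y"
      using a by (intro \<nu>.emeasure_pair_measure_Times) auto
    finally show "emeasure \<eta> {t \<in> B. p t \<in> a} \<noteq> \<infinity>"
      using A(4)[OF that] by (simp add: ennreal_mult_eq_top_iff)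
  qed
  have "countable ?S"
    using A(1) by auto
  moreover have "?S \<subseteq> sets \<eta>"
    using S by auto
  moreover have "\<Union>?S = space \<eta>"
    using A(3) B_space by auto
  moreover have "\<forall>s\<in>?S. emeasure \<eta> s \<noteq> \<infinity>"
    using S B_conull by auto
  ultimately show "\<exists>A. countable A \<and> A \<subseteq> sets \<eta> \<and> \<Union>A = space \<eta> \<and> (\<forall>a\<in>A. emeasure \<eta> a \<noteq> \<infinity>)"
    by blast
qed

section \<open>Generic points and the criterion for a trivialization\<close>

definition generic :: "'w set" where
  "generic = {t \<in> space \<eta>. emeasure lamH {h. act 0 h t \<notin> B} = 0}"

text \<open>Conull by Fubini: for each fixed h, the points that h carries out of \<open>B\<close>
  form the preimage of a null set under a measure preserving map.\<close>

lemma generic_invariant: "invariant generic"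
  unfolding invariant_def
proof (intro conjI allI ballI)
  interpret \<eta>: sigma_finite_measure \<eta>
    by (rule sigma_finite_\<eta>)
  interpret pair_sigma_finite \<eta> lamH ..
  have P: "Measurable.pred (\<eta> \<Otimes>\<^sub>M borel) (\<lambda>(t, h). act 0 h t \<notin> B)"
    by measurable
  have m [measurable]: "(\<lambda>t. emeasure lamH {h. act 0 h t \<notin> B}) \<in> borel_measurable \<eta>"
    by (rule measurable_measure_section(1)[OF lamH.sigma_finite_measure_axioms sets_lam(2) P])
  show "generic \<in> sets \<eta>"
    unfolding generic_def by measurable
  let ?D = "{x \<in> space (\<eta> \<Otimes>\<^sub>M lamH). act 0 (snd x) (fst x) \<notin> B}"
  have D: "?D \<in> sets (\<eta> \<Otimes>\<^sub>M lamH)"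
    by measurable
  have "(\<integral>\<^sup>+t. emeasure lamH {h. act 0 h t \<notin> B} \<partial>\<eta>) = (\<integral>\<^sup>+t. emeasure lamH (Pair t -` ?D) \<partial>\<eta>)"
    by (intro nn_integral_cong arg_cong2[where f = emeasure]) (auto simp: space_pair_measure)
  also have "\<dots> = emeasure (\<eta> \<Otimes>\<^sub>M lamH) ?D"
    by (rule lamH.emeasure_pair_measure_alt[OF D, symmetric])
  also have "\<dots> = (\<integral>\<^sup>+h. emeasure \<eta> ((\<lambda>t. (t, h)) -` ?D) \<partial>lamH)"
    by (rule emeasure_pair_measure_alt2[OF D])
  also have "\<dots> = (\<integral>\<^sup>+h. emeasure \<eta> {t \<in> space \<eta>. act 0 h t \<in> space \<eta> - B} \<partial>lamH)"
    by (intro nn_integral_cong arg_cong2[where f = emeasure]) (auto simp: space_pair_measure act_space)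
  also have "\<dots> = 0"
    using B_conull by (subst emeasure_act) auto
  finally have "emeasure \<eta> {t \<in> space \<eta>. emeasure lamH {h. act 0 h t \<notin> B} \<noteq> 0} = 0"
    using nn_integral_0_iff[OF m] by simp
  moreover have "space \<eta> - generic = {t \<in> space \<eta>. emeasure lamH {h. act 0 h t \<notin> B} \<noteq> 0}"
    by (auto simp: generic_def)
  ultimately show "emeasure \<eta> (space \<eta> - generic) = 0"
    by simp
  fix g h t assume "t \<in> generic"
  then have t: "t \<in> space \<eta>" "emeasure lamH {h. act 0 h t \<notin> B} = 0"
    by (auto simp: generic_def)
  have D: "{h. act 0 h t \<notin> B} \<in> sets borel"
    using t(1) by measurable
  \<comment> \<open>Moving t by (g, h) translates its set of bad elements of H on the right and, as
    \<open>B\<close> is G-invariant, changes nothing else; right invariance of \<open>lamH\<close>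
    keeps it null.\<close>
  have "{h'. act 0 h' (act g h t) \<notin> B} = (\<lambda>x. x + - h) ` {h. act 0 h t \<notin> B}"
  proof -
    have "act 0 h' (act g h t) \<in> B \<longleftrightarrow> act 0 (h' + h) t \<in> B" for h'
    proof -
      have "act 0 h' (act g h t) = act g 0 (act 0 (h' + h) t)"
        using t(1) by (simp add: act_act)
      then show ?thesis
        using B_act_iff[OF act_space[OF t(1)]] by simp
    qed
    then show ?thesis
      by (auto intro!: image_eqI[where x = "h' + h" for h'])
  qed
  also have "emeasure lamH \<dots> = emeasure lamH {h. act 0 h t \<notin> B}"
    using haarH D unfolding unimodular_haar_def by blast
  finally show "act g h t \<in> generic"
    using t by (simp add: generic_def act_space)
qed

text \<open>The equivariant Borel isomorphism that the theorem demands on the G side, for the set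
  \<open>W\<close> and the unchanged action. Swapping the groups gives the demand on the H
  side.\<close>

definition trivialized :: "'w set \<Rightarrow> bool" where
  "trivialized W \<longleftrightarrow> (\<exists>Y'. Y' \<in> sets \<nu> \<and> emeasure \<nu> (space \<nu> - Y') = 0 \<and>
     (\<exists>i'. borel_iso (lamG \<Otimes>\<^sub>M restrict_space \<nu> Y') (restrict_space \<eta> W) i' \<and>
        distr (lamG \<Otimes>\<^sub>M restrict_space \<nu> Y') (restrict_space \<eta> W) i' = restrict_space \<eta> W \<and>
        (\<forall>g0 g y. y \<in> Y' \<longrightarrow> i' (g0 + g, y) = act g0 0 (i' (g, y)))))"

text \<open>A Borel section \<open>s\<close> with coordinates \<open>P\<close> and \<open>r\<close>
  on \<open>W\<close> gives the bijection taking (g, y) to \<open>act g 0 (s y)\<close>, with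
  inverse taking t to \<open>(P t, r t)\<close>. It preserves measure because it agrees with
  \<open>i\<close> off a null set of y, so changing the section on a null set of parameters is
  free.\<close>

lemma trivializedI:
  assumes W: "invariant W" and Y': "Y' \<in> sets \<nu>" "emeasure \<nu> (space \<nu> - Y') = 0"
    and [measurable]: "s \<in> \<nu> \<rightarrow>\<^sub>M \<eta>" "r \<in> \<eta> \<rightarrow>\<^sub>M \<nu>" "P \<in> borel_measurable \<eta>"
    and s: "\<And>y. y \<in> Y' \<Longrightarrow> s y \<in> W \<and> P (s y) = 0 \<and> r (s y) = y"
    and r: "\<And>t. t \<in> W \<Longrightarrow> r t \<in> Y' \<and> act (P t) 0 (s (r t)) = t"
    and equiv: "\<And>g t. t \<in> W \<Longrightarrow> P (act g 0 t) = g + P t \<and> r (act g 0 t) = r t"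
    and N: "N \<in> null_sets \<nu>" "\<And>y. y \<in> Y' \<Longrightarrow> y \<notin> N \<Longrightarrow> s y = i (0, y)"
  shows "trivialized W"
proof -
  note Wd = invariantD[OF W]
  have [measurable]: "W \<in> sets \<eta>" "Y' \<in> sets \<nu>"
    by fact+
  have Ysp: "Y' \<subseteq> space \<nu>"
    using Y'(1) by (rule sets.sets_into_space)
  define i' where "i' x = act (fst x) 0 (s (snd x))" for x
  define f' where "f' t = (P t, r t)" for t
  let ?M = "lamG \<Otimes>\<^sub>M restrict_space \<nu> Y'" and ?N = "restrict_space \<eta> W"
  have spM: "space ?M = UNIV \<times> Y'"
    using Ysp by (auto simp: space_pair_measure space_restrict_space)
  have spN: "space ?N = W"
    using Wd(2) by (auto simp: space_restrict_space)
  have idY: "(\<lambda>y. y) \<in> restrict_space \<nu> Y' \<rightarrow>\<^sub>M \<nu>"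
    by (intro measurable_restrict_space1 measurable_ident_sets refl)
  have i'_W: "i' x \<in> W" if "x \<in> UNIV \<times> Y'" for x
    using that s[of "snd x"] Wd(4) by (auto simp: i'_def)
  have i'm: "i' \<in> ?M \<rightarrow>\<^sub>M ?N"
  proof (rule measurable_restrict_space2)
    show "i' \<in> space ?M \<rightarrow> W"
      using i'_W spM by auto
    have "(\<lambda>x. s (snd x)) \<in> ?M \<rightarrow>\<^sub>M \<eta>"
      using measurable_compose[OF measurable_compose[OF measurable_snd idY] \<open>s \<in> \<nu> \<rightarrow>\<^sub>M \<eta>\<close>] .
    then show "i' \<in> ?M \<rightarrow>\<^sub>M \<eta>"
      unfolding i'_def by (intro act_measurable) auto
  qed
  have f'm: "f' \<in> ?N \<rightarrow>\<^sub>M ?M"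
    unfolding f'_def
  proof (rule measurable_Pair)
    show "P \<in> ?N \<rightarrow>\<^sub>M lamG"
      by (rule measurable_restrict_space1) measurable
    show "r \<in> ?N \<rightarrow>\<^sub>M restrict_space \<nu> Y'"
      using r spN by (intro measurable_restrict_space2 measurable_restrict_space1) auto
  qed
  have f'i': "f' (i' x) = x" if "x \<in> UNIV \<times> Y'" for x
    using that s[of "snd x"] equiv[of "s (snd x)" "fst x"] by (auto simp: f'_def i'_def)
  have i'f': "i' (f' t) = t" if "t \<in> W" for t
    using r[OF that] by (simp add: f'_def i'_def)
  have "bij_betw i' (space ?M) (space ?N)"
    unfolding spM spN
    by (rule bij_betw_byWitness[where f' = f']) (use f'i' i'f' i'_W r in \<open>auto simp: f'_def\<close>)
  then have iso: "borel_iso ?M ?N i'"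
    unfolding borel_iso_def using i'm f'm f'i' i'f' spM spN by (intro conjI exI[of _ f']) auto
  have "distr ?M ?N i' = ?N"
  proof (rule measure_eqI)
    fix Z assume "Z \<in> sets (distr ?M ?N i')"
    then have Z: "Z \<in> sets ?N" "Z \<in> sets \<eta>" "Z \<subseteq> W"
      using Wd(1,2) by (auto simp: sets_restrict_space_iff)
    note [measurable] = Z(2)
    let ?S = "{x \<in> UNIV \<times> Y'. i' x \<in> Z}" and ?T = "{x \<in> UNIV \<times> Y. i x \<in> Z \<inter> B}"
    have "?S = {x \<in> space (lamG \<Otimes>\<^sub>M \<nu>). snd x \<in> Y' \<and> act (fst x) 0 (s (snd x)) \<in> Z}"
      using Ysp by (auto simp: space_pair_measure i'_def)
    also have "\<dots> \<in> sets (lamG \<Otimes>\<^sub>M \<nu>)"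
      by measurable
    finally have Sm: "?S \<in> sets (lamG \<Otimes>\<^sub>M \<nu>)" .
    have "?T = {x \<in> space (lamG \<Otimes>\<^sub>M \<nu>). snd x \<in> Y \<and> i x \<in> Z \<inter> B}"
      using Y_space by (auto simp: space_pair_measure)
    also have "\<dots> \<in> sets (lamG \<Otimes>\<^sub>M \<nu>)"
      by measurable
    finally have Tm: "?T \<in> sets (lamG \<Otimes>\<^sub>M \<nu>)" .
    have null: "UNIV \<times> (N \<union> (space \<nu> - Y) \<union> (space \<nu> - Y')) \<in> null_sets (lamG \<Otimes>\<^sub>M \<nu>)"
    proof -
      have "N \<union> (space \<nu> - Y) \<union> (space \<nu> - Y') \<in> null_sets \<nu>"
        using N(1) Y_conull Y'(2) by (intro null_sets.Un) (auto intro!: null_setsI)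
      then show ?thesis
        by (intro \<nu>.times_in_null_sets2) auto
    qed
    have "emeasure (distr ?M ?N i') Z = emeasure ?M (i' -` Z \<inter> space ?M)"
      using i'm Z(1) by (rule emeasure_distr)
    also have "i' -` Z \<inter> space ?M = ?S"
      by (auto simp: spM)
    also have "emeasure ?M ?S = emeasure (lamG \<Otimes>\<^sub>M \<nu>) ?S"
      using Sm by (intro emeasure_pair_restrict_space finite_\<nu> Y'(1)) auto
    also have "\<dots> = emeasure (lamG \<Otimes>\<^sub>M \<nu>) ?T"
    proof (rule emeasure_eq_AE[OF _ Sm Tm], rule AE_I'[OF null], rule subsetI, rule ccontr)
      fix x assume x: "x \<in> {x \<in> space (lamG \<Otimes>\<^sub>M \<nu>). \<not> (x \<in> ?S \<longleftrightarrow> x \<in> ?T)}"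
        "x \<notin> UNIV \<times> (N \<union> (space \<nu> - Y) \<union> (space \<nu> - Y'))"
      obtain g y where gy: "x = (g, y)"
        by (cases x)
      have y: "y \<in> Y'" "y \<in> Y" "y \<notin> N"
        using x by (auto simp: gy space_pair_measure)
      have "i' (g, y) = i (g, y)"
        using N(2)[OF y(1,3)] i_eq_act[OF y(2), of g] by (simp add: i'_def)
      then show False
        using x(1) y pq_i[OF y(2), of g] by (auto simp: gy)
    qed
    also have "\<dots> = emeasure \<eta> (Z \<inter> B)"
      by (rule emeasure_i[symmetric]) auto
    also have "\<dots> = emeasure \<eta> Z"
    proof (rule emeasure_eq_AE)
      show "AE x in \<eta>. x \<in> Z \<inter> B \<longleftrightarrow> x \<in> Z"
        by (rule AE_I'[of "space \<eta> - B"]) (use B_conull in \<open>auto intro!: null_setsI\<close>)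
    qed auto
    also have "\<dots> = emeasure ?N Z"
      using Wd(1) Z(3) by (intro emeasure_restrict_space[symmetric]) auto
    finally show "emeasure (distr ?M ?N i') Z = emeasure ?N Z" .
  qed simp
  moreover have "i' (g0 + g, y) = act g0 0 (i' (g, y))" if "y \<in> Y'" for g0 g y
    using s[OF that] Wd(2) by (auto simp: i'_def act_act)
  ultimately show ?thesis
    unfolding trivialized_def using Y' iso by blast
qed

text \<open>As \<open>W\<close> is invariant, \<open>Y'\<close> consists of the parameters of the
  orbits inside \<open>W\<close>. The other orbits over \<open>Y\<close> lie in the null complement
  of \<open>W\<close>, so \<open>strip_null_iff\<close> makes their parameters null.\<close>

lemma section_conull:
  assumes W: "invariant W"
  defines "Y' \<equiv> {y \<in> Y. i (0, y) \<in> W}"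
  shows "Y' \<in> sets \<nu>" "emeasure \<nu> (space \<nu> - Y') = 0"
proof -
  note Wd = invariantD[OF W]
  note [measurable] = Wd(1)
  have "Y' = {y \<in> space \<nu>. y \<in> Y \<and> i (0, y) \<in> W}"
    using Y_space by (auto simp: Y'_def)
  also have "\<dots> \<in> sets \<nu>" by measurable
  finally show Y': "Y' \<in> sets \<nu>" .
  have "{t \<in> B. q t \<in> Y - Y'} \<subseteq> space \<eta> - W"
  proof
    fix t assume t: "t \<in> {t \<in> B. q t \<in> Y - Y'}"
    then have "i (0, q t) \<notin> W" by (auto simp: Y'_def)
    then show "t \<in> space \<eta> - W"
      using Wd(4)[of t "- p t" 0] act_p_i_q[of t] t B_space by auto
  qed
  then have "emeasure \<eta> {t \<in> B. q t \<in> Y - Y'} \<le> emeasure \<eta> (space \<eta> - W)"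
    by (rule emeasure_mono) simp
  then have "emeasure \<nu> (Y - Y') = 0"
    using Wd(3) strip_null_iff[of "Y - Y'"] Y' by simp
  then have "(space \<nu> - Y) \<union> (Y - Y') \<in> null_sets \<nu>"
    using Y_conull Y' by (intro null_sets.Un) (auto intro!: null_setsI)
  moreover have "(space \<nu> - Y) \<union> (Y - Y') = space \<nu> - Y'"
    using Y_space by (auto simp: Y'_def)
  ultimately show "emeasure \<nu> (space \<nu> - Y') = 0" by auto
qed

text \<open>Inside \<open>B\<close> the given coordinates are valid everywhere, so the old section
  is kept. This settles the atomic case.\<close>

lemma trivialized_subset:
  assumes W: "invariant W" "W \<subseteq> B"
  shows "trivialized W"
proof (rule trivializedI[OF W(1) section_conull[OF W(1)]])
  note Wd = invariantD[OF W(1)]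
  show "(\<lambda>y. i (0, y)) \<in> \<nu> \<rightarrow>\<^sub>M \<eta>" "q \<in> \<eta> \<rightarrow>\<^sub>M \<nu>" "p \<in> borel_measurable \<eta>"
    by measurable
  show "i (0, y) \<in> W \<and> p (i (0, y)) = 0 \<and> q (i (0, y)) = y" if "y \<in> {y \<in> Y. i (0, y) \<in> W}" for y
    using that pq_i[of y 0] by simp
  show "q t \<in> {y \<in> Y. i (0, y) \<in> W} \<and> act (p t) 0 (i (0, q t)) = t" if "t \<in> W" for t
  proof -
    have "i (0, q t) \<in> W"
      using Wd(4)[OF that, of "- p t" 0] act_p_i_q[of t] that W(2) by auto
    then show ?thesis
      using that W(2) i_pq[of t] i_eq_act[of "q t" "p t"] by auto
  qed
  show "p (act g 0 t) = g + p t \<and> q (act g 0 t) = q t" if "t \<in> W" for g t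
    using pq_act[of t g] that W(2) by auto
  show "{} \<in> null_sets \<nu>" by simp
qed simp


text \<open>The selector is applied to the function of h given by \<open>p (act 0 h t)\<close>,
  meaningful for almost every h because t is generic. As the actions commute, moving t by g adds g
  on the left of every meaningful value.\<close>

lemma equivariant_extension:
  assumes W: "invariant W" "W \<subseteq> generic"
  obtains P where "P \<in> borel_measurable \<eta>" "\<And>g t. t \<in> W \<Longrightarrow> P (act g 0 t) = g + P t"
    "\<And>t. t \<in> B \<Longrightarrow> P t = p t"
proof -
  note Wd = invariantD[OF W(1)]
  note [measurable] = Wd(1)
  let ?M = "restrict_space \<eta> W"
  have sp: "space ?M = W"
    using Wd(2) by (auto simp: space_restrict_space)
  obtain K where K [measurable]: "K \<in> sets borel" and Kp: "0 < emeasure lamH K" "emeasure lamH K < \<infinity>"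
    using haar_compact_pos[OF H] haarH unfolding unimodular_haar_def by blast
  \<comment> \<open>The selector needs a finite measure on H, so Haar measure is cut down to a set
    of finite positive mass. For generic t the meaningful h still have full measure.\<close>
  define \<sigma> where "\<sigma> = density lamH (indicator K)"
  have \<sigma>: "emeasure \<sigma> D = emeasure lamH (K \<inter> D)" if "D \<in> sets borel" for D
    unfolding \<sigma>_def by (rule emeasure_restricted) (use that in auto)
  have \<sigma>_sets: "sets \<sigma> = sets borel"
    by (simp add: \<sigma>_def)
  have \<sigma>_fin: "finite_measure \<sigma>"
  proof (rule finite_measureI)
    have "space \<sigma> = UNIV" by (simp add: \<sigma>_def)
    then show "emeasure \<sigma> (space \<sigma>) \<noteq> \<infinity>"
      using \<sigma>[of UNIV] Kp(2) by simp
  qed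
  have id [measurable]: "(\<lambda>t. t) \<in> ?M \<rightarrow>\<^sub>M \<eta>"
    by (intro measurable_restrict_space1 measurable_ident_sets refl)
  have fst_meas [measurable]: "fst \<in> ?M \<Otimes>\<^sub>M borel \<rightarrow>\<^sub>M \<eta>"
    using measurable_compose[OF measurable_fst id] .
  obtain P0 where P0: "P0 \<in> borel_measurable ?M"
    "\<And>t t' g. t \<in> space ?M \<Longrightarrow> t' \<in> space ?M \<Longrightarrow> (\<And>h. act 0 h t' \<in> B \<longleftrightarrow> act 0 h t \<in> B) \<Longrightarrow>
      (\<And>h. act 0 h t \<in> B \<Longrightarrow> p (act 0 h t') = g + p (act 0 h t)) \<Longrightarrow> P0 t' = g + P0 t"
  proof (rule equivariant_selector[where M = ?M and ?E0.0 = "\<lambda>t h. act 0 h t \<in> B"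
        and F = "\<lambda>t h. p (act 0 h t)", OF G \<sigma>_fin \<sigma>_sets])
    show "Measurable.pred (?M \<Otimes>\<^sub>M borel) (\<lambda>(t, h). act 0 h t \<in> B)"
      "(\<lambda>(t, h). p (act 0 h t)) \<in> borel_measurable (?M \<Otimes>\<^sub>M borel)"
      unfolding split_beta by measurable
    fix t assume "t \<in> space ?M"
    then have t: "t \<in> space \<eta>" "emeasure lamH {h. act 0 h t \<notin> B} = 0"
      using W(2) sp by (auto simp: generic_def)
    have m: "{h. act 0 h t \<in> B} \<in> sets borel" "{h. act 0 h t \<notin> B} \<in> sets borel"
      using t(1) by measurable
    have "emeasure lamH (K \<inter> {h. act 0 h t \<in> B}) = emeasure lamH K"
    proof (rule emeasure_eq_AE)
      show "AE h in lamH. h \<in> K \<inter> {h. act 0 h t \<in> B} \<longleftrightarrow> h \<in> K"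
        by (rule AE_I'[of "{h. act 0 h t \<notin> B}"]) (use t(2) m(2) in \<open>auto intro!: null_setsI\<close>)
    qed (use m in auto)
    then show "emeasure \<sigma> {h. act 0 h t \<in> B} \<noteq> 0"
      using \<sigma>[OF m(1)] Kp(1) by simp
  qed blast
  have P0_act: "P0 (act g 0 t) = g + P0 t" if t: "t \<in> W" for g t
  proof (rule P0(2))
    have tsp: "t \<in> space \<eta>" using t Wd(2) by auto
    have comm: "act 0 h (act g 0 t) = act g 0 (act 0 h t)" for h
      using tsp by (simp add: act_act)
    show "t \<in> space ?M" "act g 0 t \<in> space ?M"
      using t Wd(4) sp by auto
    show "act 0 h (act g 0 t) \<in> B \<longleftrightarrow> act 0 h t \<in> B" for h
      unfolding comm by (rule B_act_iff) (rule act_space[OF tsp])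
    show "p (act 0 h (act g 0 t)) = g + p (act 0 h t)" if "act 0 h t \<in> B" for h
      unfolding comm by (rule pq_act(1)[OF that])
  qed
  \<comment> \<open>Keeping \<open>p\<close> on \<open>B\<close> makes the new section differ from
    the old one only because of orbits outside \<open>B\<close>. As \<open>B\<close> is G-invariant,
    the two formulas never meet on one orbit.\<close>
  define P where "P t = (if t \<in> B then p t else if t \<in> W then P0 t else 0)" for t
  show thesis
  proof (rule that[of P])
    have "(\<lambda>t. if t \<in> W then P0 t else 0) \<in> borel_measurable \<eta>"
      by (subst measurable_If_restrict_space_iff) (use P0(1) Wd(1) in auto)
    then show "P \<in> borel_measurable \<eta>"
      unfolding P_def by measurable
    show "P (act g 0 t) = g + P t" if "t \<in> W" for g t
      using that P0_act[OF that] Wd(2,4) pq_act(1)[of t g] B_act_iff[of t g] by (auto simp: P_def)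
  qed (simp add: P_def)
qed

text \<open>The null set of orbits in \<open>W\<close> that miss \<open>B\<close> is absorbed by a Hilbert hotel: it is coded by a
  Borel set \<open>N\<close> of reals in \<open>[0, 1)\<close>, and \<open>shift\<close> makes room for it inside a null copy of the real
  line in \<open>Y\<close>.\<close>

lemma trivialized_generic:
  assumes W: "invariant W" "W \<subseteq> generic"
    and atomless: "emeasure \<nu> {y \<in> Y. emeasure \<nu> {y} = 0} \<noteq> 0"
  shows "trivialized W"
proof -
  note Wd = invariantD[OF W(1)]
  note [measurable] = Wd(1)
  define Y' where "Y' = {y \<in> Y. i (0, y) \<in> W}"
  have Y': "Y' \<in> sets \<nu>" "emeasure \<nu> (space \<nu> - Y') = 0"
    unfolding Y'_def by (rule section_conull[OF W(1)])+
  obtain P where P [measurable]: "P \<in> borel_measurable \<eta>"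
    and P_act: "\<And>g t. t \<in> W \<Longrightarrow> P (act g 0 t) = g + P t" and P_p: "\<And>t. t \<in> B \<Longrightarrow> P t = p t"
    by (rule equivariant_extension[OF W that])
  have "space \<eta> \<noteq> {}"
    using \<eta>_nonzero by auto
  obtain e :: "'w \<Rightarrow> real" and e' where e [measurable]: "e \<in> borel_measurable \<eta>" "e' \<in> borel \<rightarrow>\<^sub>M \<eta>"
    and e'e: "\<And>t. t \<in> space \<eta> \<Longrightarrow> e' (e t) = t" and e01: "\<And>t. 0 \<le> e t" "\<And>t. e t < 1"
    by (rule standard_borel_real_embedding[OF borel_\<eta> \<open>space \<eta> \<noteq> {}\<close> that])
  define D where "D = {y \<in> space \<nu>. emeasure \<nu> {y} = 0}"
  have D: "D \<in> sets \<nu>"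
    unfolding D_def by (rule standard_borel_atoms[OF borel_\<nu> finite_\<nu>])
  \<comment> \<open>The rooms of the hotel must be parameters of orbits inside \<open>W\<close>, so
    the non-atomic part is moved from \<open>Y\<close> to its conull subset
    \<open>Y'\<close>.\<close>
  have "emeasure \<nu> (Y \<inter> D) = emeasure \<nu> (Y' \<inter> D)"
  proof (rule emeasure_eq_AE)
    show "AE y in \<nu>. y \<in> Y \<inter> D \<longleftrightarrow> y \<in> Y' \<inter> D"
      by (rule AE_I'[of "space \<nu> - Y'"]) (use Y' in \<open>auto simp: Y'_def intro!: null_setsI\<close>)
  qed (use D Y'(1) in auto)
  moreover have "{y \<in> X. emeasure \<nu> {y} = 0} = X \<inter> D" if "X \<subseteq> space \<nu>" for X
    unfolding D_def using that by blast
  ultimately have "emeasure \<nu> {y \<in> Y'. emeasure \<nu> {y} = 0} \<noteq> 0"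
    using atomless Y_space sets.sets_into_space[OF Y'(1)] by metis
  then obtain z z' where z [measurable]: "z \<in> borel \<rightarrow>\<^sub>M \<nu>" "z' \<in> borel_measurable \<nu>"
    and z'z: "\<And>x::real. z' (z x) = x" and zY': "\<And>x. z x \<in> Y'" and z_null: "range z \<in> null_sets \<nu>"
    by (rule null_copy_of_real[OF borel_\<nu> finite_\<nu> Y'(1) _ that])
  have [measurable]: "range z \<in> sets \<nu>"
    using z_null by auto
  \<comment> \<open>One code for each G-orbit in \<open>W\<close> outside \<open>B\<close>, namely
    that of its unique point with \<open>P\<close> equal to 0.\<close>
  define N where "N = {x. e' x \<in> W - B \<and> P (e' x) = 0 \<and> e (e' x) = x}"
  have [measurable]: "N \<in> sets borel"
    unfolding N_def by measurable
  have N01: "0 \<le> x" "x < 1" if "x \<in> N" for x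
    using that e01[of "e' x"] by (auto simp: N_def)
  \<comment> \<open>For x in \<open>N\<close>, the rooms x, x + 1, x + 2, ... all move up by one; as
    \<open>N\<close> lies in [0, 1), exactly \<open>N\<close> is vacated. The sign condition keeps x
    - 1 from moving onto x.\<close>
  define shift where "shift x = (if 0 \<le> x \<and> frac x \<in> N then x + 1 else x)" for x :: real
  define unshift where "unshift x = (if 1 \<le> x \<and> frac x \<in> N then x - 1 else x)" for x :: real
  have frac1: "frac (x + 1) = frac x" "frac (x - 1) = frac x" for x :: real
    by (simp_all add: frac_def)
  have fracN: "frac x = x" if "x \<in> N" for x
    using N01[OF that] by (simp add: frac_eq)
  have unshift_shift: "unshift (shift x) = x" for x
  proof (cases "0 \<le> x \<and> frac x \<in> N")
    case False
    then show ?thesis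
      unfolding shift_def unshift_def by auto
  qed (simp add: shift_def unshift_def frac1)
  have shift_N: "shift x \<notin> N" for x
  proof
    assume "shift x \<in> N"
    then show False
      using fracN[of "shift x"] N01[of "shift x"] by (auto simp: shift_def frac1 split: if_splits)
  qed
  have shift_unshift: "shift (unshift x) = x" if "x \<notin> N" for x
  proof (cases "1 \<le> x \<and> frac x \<in> N")
    case True
    then show ?thesis
      by (simp add: shift_def unshift_def frac1)
  next
    case False
    have "frac x = x" if "0 \<le> x" "\<not> 1 \<le> x"
      using that by (simp add: frac_eq)
    then show ?thesis
      using False that by (auto simp: shift_def unshift_def)
  qed
  have [measurable]: "shift \<in> borel_measurable borel" "unshift \<in> borel_measurable borel"
    unfolding shift_def unshift_def frac_def by measurable
  \<comment> \<open>The room \<open>z x\<close> receives the newcomer \<open>e' x\<close> if x is in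
    \<open>N\<close>, and otherwise the orbit that used to live over \<open>z (unshift x)\<close>.
    Below, \<open>rep t\<close> is the point of the orbit of t chosen by the new section, and
    \<open>r t\<close> is its room.\<close>
  define s where "s y = (if y \<in> range z then
      if z' y \<in> N then e' (z' y) else i (0, z (unshift (z' y))) else i (0, y))" for y
  define rep where "rep t = act (- P t) 0 t" for t
  define r where "r t = (if t \<in> B then
      if q t \<in> range z then z (shift (z' (q t))) else q t else z (e (rep t)))" for t
  have Y'D: "y \<in> Y" "i (0, y) \<in> W" "i (0, y) \<in> B" "p (i (0, y)) = 0" "q (i (0, y)) = y" if "y \<in> Y'" for y
    using that pq_i[of y 0] by (auto simp: Y'_def)
  have zero: "act 0 0 t = t" if "t \<in> W" for t
    using that Wd(2) act_zero by auto
  have rep_W: "rep t \<in> W" "P (rep t) = 0" if "t \<in> W" for t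
    unfolding rep_def using Wd(4)[OF that] P_act[OF that, of "- P t"] by simp_all
  have rep_act: "rep (act g 0 t) = rep t" if "t \<in> W" for g t
  proof -
    have "t \<in> space \<eta>" using that Wd(2) by auto
    then show ?thesis
      unfolding rep_def P_act[OF that] by (simp add: act_act minus_add add.assoc)
  qed
  have act_rep: "act (P t) 0 (rep t) = t" if "t \<in> W" for t
    unfolding rep_def using that Wd(2) by (auto simp: act_act act_zero)
  have rep_B: "rep t \<in> B \<longleftrightarrow> t \<in> B" if "t \<in> W" for t
    unfolding rep_def using that Wd(2) by (intro B_act_iff) auto
  have q_Y': "q t \<in> Y'" if "t \<in> W" "t \<in> B" for t
    using Wd(4)[OF that(1), of "- p t" 0] act_p_i_q[OF that(2)] i_pq[OF that(2)] by (simp add: Y'_def)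
  have hotel: "s (r t) = rep t \<and> r t \<in> Y'" if t: "t \<in> W" for t
  proof (cases "t \<in> B")
    case True
    have rep: "rep t = i (0, q t)"
      using act_p_i_q[OF True] by (simp add: rep_def P_p[OF True])
    show ?thesis
    proof (cases "q t \<in> range z")
      case True
      then obtain x where x: "q t = z x" by blast
      have "r t = z (shift x)"
        using \<open>t \<in> B\<close> by (simp add: r_def x z'z)
      moreover have "s (z (shift x)) = i (0, z x)"
        by (simp add: s_def z'z shift_N unshift_shift)
      ultimately show ?thesis
        using rep x zY' by simp
    next
      case False
      then show ?thesis
        using \<open>t \<in> B\<close> rep q_Y'[OF t] by (simp add: r_def s_def)
    qed
  next
    case False
    have sp: "rep t \<in> space \<eta>"
      using rep_W(1)[OF t] Wd(2) by auto
    have "e (rep t) \<in> N"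
      unfolding N_def using rep_W[OF t] rep_B[OF t] False e'e[OF sp] by simp
    then show ?thesis
      using False e'e[OF sp] zY' by (simp add: r_def s_def z'z)
  qed
  show ?thesis
  proof (rule trivializedI[OF W(1) Y'])
    show "s \<in> \<nu> \<rightarrow>\<^sub>M \<eta>"
      unfolding s_def by measurable
    show "r \<in> \<eta> \<rightarrow>\<^sub>M \<nu>"
      unfolding r_def rep_def by measurable
    show "P \<in> borel_measurable \<eta>" by fact
    show "range z \<in> null_sets \<nu>" by fact
    show "s y = i (0, y)" if "y \<notin> range z" for y
      using that by (simp add: s_def)
    show "r t \<in> Y' \<and> act (P t) 0 (s (r t)) = t" if "t \<in> W" for t
      using hotel[OF that] act_rep[OF that] by simp
    show "P (act g 0 t) = g + P t \<and> r (act g 0 t) = r t" if "t \<in> W" for g t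
      using P_act[OF that] rep_act[OF that] B_act_iff[of t g] pq_act(2)[of t g] that Wd(2)
      by (auto simp: r_def)
    show "s y \<in> W \<and> P (s y) = 0 \<and> r (s y) = y" if y: "y \<in> Y'" for y
    proof (cases "y \<in> range z")
      case True
      then obtain x where x: "y = z x" by blast
      show ?thesis
      proof (cases "x \<in> N")
        case True
        then have eN: "e' x \<in> W" "e' x \<notin> B" "P (e' x) = 0" "e (e' x) = x"
          by (auto simp: N_def)
        then have "rep (e' x) = e' x"
          by (simp add: rep_def zero)
        then show ?thesis
          using True eN by (simp add: x s_def r_def z'z)
      next
        case False
        note D = Y'D[OF zY'[of "unshift x"]]
        have "s y = i (0, z (unshift x))"
          using False by (simp add: x s_def z'z)
        then show ?thesis
          using D P_p[OF D(3)] False by (simp add: x r_def z'z shift_unshift)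
      qed
    next
      case False
      note D = Y'D[OF y]
      show ?thesis
        using D P_p[OF D(3)] False by (simp add: s_def r_def)
    qed
  qed
qed

text \<open>The actions commute and preserve the measure, so (g, h) carries a G-orbit of positive
  measure to another one. This image meets the conull set \<open>V\<close>, which is G-invariant and
  therefore contains all of it.\<close>

lemma atomic_invariant:
  assumes atomic: "emeasure \<nu> {y \<in> Y. emeasure \<nu> {y} = 0} = 0"
  defines "V \<equiv> {t \<in> B. emeasure \<nu> {q t} \<noteq> 0}"
  shows "invariant V"
proof -
  have atoms [measurable]: "{y \<in> space \<nu>. emeasure \<nu> {y} = 0} \<in> sets \<nu>"
    by (rule standard_borel_atoms[OF borel_\<nu> finite_\<nu>])
  have q_space: "q t \<in> space \<nu>" if "t \<in> B" for t
    using i_pq[OF that] Y_space by auto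
  have "V = {t \<in> space \<eta>. t \<in> B \<and> \<not> q t \<in> {y \<in> space \<nu>. emeasure \<nu> {y} = 0}}"
    unfolding V_def using B_space q_space by blast
  also have "\<dots> \<in> sets \<eta>" by measurable
  finally have V: "V \<in> sets \<eta>" .
  have VB: "V \<subseteq> B" by (auto simp: V_def)
  have V_conull: "emeasure \<eta> (space \<eta> - V) = 0"
  proof -
    let ?D = "{y \<in> Y. emeasure \<nu> {y} = 0}"
    have "?D = Y \<inter> {y \<in> space \<nu>. emeasure \<nu> {y} = 0}"
      using Y_space by blast
    then have D: "?D \<in> sets \<nu>" by simp
    have "B - V = {t \<in> B. q t \<in> ?D}"
      using i_pq by (auto simp: V_def)
    then have "emeasure \<eta> (B - V) = 0"
      using strip_null_iff[OF D] atomic by simp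
    then have "(space \<eta> - B) \<union> (B - V) \<in> null_sets \<eta>"
      using B_conull V by (intro null_sets.Un) (auto intro!: null_setsI)
    moreover have "(space \<eta> - B) \<union> (B - V) = space \<eta> - V"
      using VB B_space by auto
    ultimately show ?thesis by auto
  qed
  have V_act: "act g 0 t \<in> V" if "t \<in> V" for g t
    using that B_act[of t g] pq_act(2)[of t g] by (auto simp: V_def)
  have "act g h t \<in> V" if t: "t \<in> V" for g h t
  proof -
    have tB: "t \<in> B" "t \<in> space \<eta>" "emeasure \<nu> {q t} \<noteq> 0"
      using t B_space by (auto simp: V_def)
    define Z where "Z = {s \<in> B. q s \<in> {q t}}"
    have sing: "{q t} \<in> sets \<nu>" "{q t} \<subseteq> Y"
      using standard_borel_singleton[OF borel_\<nu> q_space[OF tB(1)]] i_pq[OF tB(1)] by auto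
    have "emeasure \<eta> Z \<noteq> 0"
      unfolding Z_def using strip_null_iff[OF sing] tB(3) by simp
    moreover have "Z \<in> sets \<eta>"
    proof -
      have "Z = {s \<in> space \<eta>. s \<in> B \<and> q s \<in> {q t}}"
        using B_space by (auto simp: Z_def)
      also have "\<dots> \<in> sets \<eta>"
        using sing(1) by measurable
      finally show ?thesis .
    qed
    ultimately have "emeasure \<eta> {s \<in> space \<eta>. act (- g) (- h) s \<in> Z} \<noteq> 0"
      using emeasure_act by simp
    moreover have "emeasure \<eta> {s \<in> space \<eta>. act (- g) (- h) s \<in> Z} \<le> emeasure \<eta> (space \<eta> - V)"
      if "{s \<in> space \<eta>. act (- g) (- h) s \<in> Z} \<subseteq> space \<eta> - V"
      using that V by (intro emeasure_mono) auto
    \<comment> \<open>A point of \<open>V\<close> on the image of the orbit of t under (g, h). It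
      differs from \<open>act g h t\<close> by an element of G alone, which is computed
      next.\<close>
    ultimately obtain s where s: "s \<in> space \<eta>" "act (- g) (- h) s \<in> Z" "s \<in> V"
      using V_conull by fastforce
    define u where "u = act (- g) (- h) s"
    have u: "u \<in> B" "q u = q t" "u \<in> space \<eta>"
      using s(2) B_space by (auto simp: u_def Z_def)
    define k where "k = p u + - p t"
    have "u = act k 0 t"
      using i_pq[OF u(1)] i_pq[OF tB(1)] i_act[of "q t" k "p t"] u(2) by (simp add: k_def add.assoc)
    moreover have "s = act g h u"
      unfolding u_def using s(1) act_inverse[of s "- g" "- h"] by simp
    ultimately have "s = act (g + k) h t"
      using tB(2) by (simp add: act_act)
    then have "act (g + - (g + k)) 0 s = act g h t"
      using tB(2) by (simp add: act_act add.assoc)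
    then show ?thesis
      using V_act[OF s(3)] by metis
  qed
  then show ?thesis
    using V V_conull by (auto simp: invariant_def)
qed

text \<open>The claim covers every invariant subset of \<open>V\<close>, so that it survives
  intersection with the set found for the other group.\<close>

lemma exists_trivialized:
  obtains V where "invariant V" "\<And>W. invariant W \<Longrightarrow> W \<subseteq> V \<Longrightarrow> trivialized W"
proof (cases "emeasure \<nu> {y \<in> Y. emeasure \<nu> {y} = 0} = 0")
  case True
  show ?thesis
  proof (rule that[OF atomic_invariant[OF True]])
    fix W assume W: "invariant W" "W \<subseteq> {t \<in> B. emeasure \<nu> {q t} \<noteq> 0}"
    then show "trivialized W"
      by (intro trivialized_subset) auto
  qed
next
  case False
  show ?thesis
    by (rule that[OF generic_invariant]) (rule trivialized_generic[OF _ _ False])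
qed

end

section \<open>Coordinates from a coupling, and the theorem\<close>

text \<open>Left translation is transitive on G, so the invariant conull domain of \<open>i\<close>
  is a full product \<open>UNIV \<times> Y\<close>, and \<open>Y\<close> inherits measurability and
  conullity from it.\<close>

lemma fundamental_domain_exists:
  fixes lamG :: "'g::{group_add,t2_space,second_countable_topology} measure"
    and lamH :: "'h::{group_add,t2_space,second_countable_topology} measure"
    and act :: "'g \<Rightarrow> 'h \<Rightarrow> 'w \<Rightarrow> 'w"
  assumes G: "lcsc_group TYPE('g)" and H: "lcsc_group TYPE('h)"
    and haar: "unimodular_haar lamG" "unimodular_haar lamH"
    and mp: "mp_action act borel borel \<eta>"
    and \<eta>: "standard_borel \<eta>" "emeasure \<eta> (space \<eta>) \<noteq> 0"
    and \<nu>: "standard_borel \<nu>" "finite_measure \<nu>"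
    and iso: "iso_measure_G_spaces (\<lambda>g (g', y). (g + g', y)) (lamG \<Otimes>\<^sub>M \<nu>) (\<lambda>g t. act g 0 t) \<eta> i"
  obtains p q Y B where "fundamental_domain act \<eta> lamG lamH \<nu> i p q Y B"
proof -
  interpret \<nu>: finite_measure \<nu> by fact
  have lamG: "sets lamG = sets borel" "emeasure lamG UNIV \<noteq> 0"
    using haar(1) unfolding unimodular_haar_def haar_measure_def
    by (simp, metis UNIV_not_empty less_irrefl open_UNIV)
  have spG: "space lamG = UNIV"
    using sets_eq_imp_space_eq[OF lamG(1)] by simp
  let ?M = "lamG \<Otimes>\<^sub>M \<nu>"
  obtain A B where i: "i \<in> ?M \<rightarrow>\<^sub>M \<eta>" and A: "A \<in> sets ?M" and B: "B \<in> sets \<eta>"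
    and null: "emeasure ?M (space ?M - A) = 0" "emeasure \<eta> (space \<eta> - B) = 0"
    and A_inv: "\<And>g g' y. (g', y) \<in> A \<Longrightarrow> (g + g', y) \<in> A" and B_inv: "\<And>g t. t \<in> B \<Longrightarrow> act g 0 t \<in> B"
    and equiv: "\<And>g g' y. (g', y) \<in> A \<Longrightarrow> i (g + g', y) = act g 0 (i (g', y))"
    and biso: "borel_iso (restrict_space ?M A) (restrict_space \<eta> B) i"
    and distr: "distr (restrict_space ?M A) (restrict_space \<eta> B) i = restrict_space \<eta> B"
    using iso unfolding iso_measure_G_spaces_def by (auto simp: split_beta')
  have Asp: "A \<subseteq> space ?M" and Bsp: "B \<subseteq> space \<eta>"
    using A B by (auto dest: sets.sets_into_space)
  have sp: "space (restrict_space ?M A) = A" "space (restrict_space \<eta> B) = B"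
    using Asp Bsp by (auto simp: space_restrict_space)
  from biso obtain f where im: "i \<in> restrict_space ?M A \<rightarrow>\<^sub>M restrict_space \<eta> B"
    and fm: "f \<in> restrict_space \<eta> B \<rightarrow>\<^sub>M restrict_space ?M A"
    and f: "\<forall>x\<in>A. f (i x) = x" "\<forall>t\<in>B. i (f t) = t"
    unfolding borel_iso_def sp by blast
  have iB: "i x \<in> B" if "x \<in> A" for x
    using measurable_space[OF im] that sp by auto
  have fA: "f t \<in> A" if "t \<in> B" for t
    using measurable_space[OF fm] that sp by auto
  define Y where "Y = {y \<in> space \<nu>. (0, y) \<in> A}"
  have A_eq: "A = UNIV \<times> Y"
  proof
    show "A \<subseteq> UNIV \<times> Y"
    proof
      fix x assume x: "x \<in> A"
      then have "(- fst x + fst x, snd x) \<in> A"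
        by (intro A_inv) simp
      then show "x \<in> UNIV \<times> Y"
        using x Asp by (cases x) (auto simp: Y_def space_pair_measure)
    qed
    show "UNIV \<times> Y \<subseteq> A"
      using A_inv[of 0] by (auto simp: Y_def)
  qed
  have "Y = Pair 0 -` A"
    using Asp by (auto simp: Y_def space_pair_measure)
  then have Y: "Y \<in> sets \<nu>"
    using sets_Pair1[OF A] by simp
  have "space ?M - A = UNIV \<times> (space \<nu> - Y)"
    unfolding A_eq by (auto simp: space_pair_measure spG)
  then have "emeasure lamG UNIV * emeasure \<nu> (space \<nu> - Y) = 0"
    using null(1) Y \<nu>.emeasure_pair_measure_Times[of UNIV lamG "space \<nu> - Y"] lamG(1) by simp
  then have Y_null: "emeasure \<nu> (space \<nu> - Y) = 0"
    using lamG(2) by simp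
  \<comment> \<open>A nonzero measure gives \<open>B\<close> a point, whose second coordinate
    \<open>y0\<close> serves as the default value of \<open>q\<close> off \<open>B\<close>; a total
    map into the parameter space needs one.\<close>
  have "B \<noteq> {}"
    using null(2) \<eta>(2) by auto
  then obtain t0 where "t0 \<in> B"
    by blast
  then have "f t0 \<in> UNIV \<times> Y"
    using fA A_eq by simp
  then obtain y0 where y0: "y0 \<in> space \<nu>"
    by (auto simp: Y_def)
  define p where "p t = (if t \<in> B then fst (f t) else 0)" for t
  define q where "q t = (if t \<in> B then snd (f t) else y0)" for t
  have fm': "f \<in> restrict_space \<eta> B \<rightarrow>\<^sub>M ?M"
    using fm by (simp add: measurable_restrict_space2_iff)
  show thesis
  proof (rule that, unfold_locales)
    show "p \<in> borel_measurable \<eta>"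
      unfolding p_def using measurable_compose[OF fm' measurable_fst] B lamG(1)
      by (subst measurable_If_restrict_space_iff) (auto cong: measurable_cong_sets)
    show "q \<in> \<eta> \<rightarrow>\<^sub>M \<nu>"
      unfolding q_def using measurable_compose[OF fm' measurable_snd] B y0
      by (subst measurable_If_restrict_space_iff) auto
    show "q t \<in> Y \<and> i (p t, q t) = t" if "t \<in> B" for t
      using that fA[OF that] bspec[OF f(2) that] A_eq by (auto simp: p_def q_def)
    show "i (g, y) \<in> B \<and> p (i (g, y)) = g \<and> q (i (g, y)) = y" if "y \<in> Y" for g y
      using that iB[of "(g, y)"] bspec[OF f(1), of "(g, y)"] A_eq by (simp add: p_def q_def)
    show "i (g + g', y) = act g 0 (i (g', y))" if "y \<in> Y" for g g' y
      using that equiv A_eq by auto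
    show "emeasure \<eta> Z = emeasure ?M {x \<in> UNIV \<times> Y. i x \<in> Z}" if Z: "Z \<in> sets \<eta>" "Z \<subseteq> B" for Z
    proof -
      have "emeasure \<eta> Z = emeasure (restrict_space \<eta> B) Z"
        using B Z by (intro emeasure_restrict_space[symmetric]) auto
      also have "\<dots> = emeasure (restrict_space ?M A) (i -` Z \<inter> A)"
        using im Z B sp by (subst distr[symmetric], subst emeasure_distr) (auto simp: sets_restrict_space_iff)
      also have "\<dots> = emeasure ?M (i -` Z \<inter> A)"
        using A by (intro emeasure_restrict_space) auto
      also have "i -` Z \<inter> A = {x \<in> UNIV \<times> Y. i x \<in> Z}"
        unfolding A_eq by auto
      finally show ?thesis .
    qed
  qed (fact assms Y Y_null B B_inv i null(2))+
qed

lemma mp_action_swap: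
  assumes "mp_action act borel borel M"
  shows "mp_action (\<lambda>h g. act g h) borel borel M"
proof -
  have act: "(\<lambda>(g, h, t). act g h t) \<in> borel \<Otimes>\<^sub>M borel \<Otimes>\<^sub>M M \<rightarrow>\<^sub>M M"
    using assms by (simp add: mp_action_def)
  have swap: "(\<lambda>x. (fst (snd x), fst x, snd (snd x))) \<in> borel \<Otimes>\<^sub>M borel \<Otimes>\<^sub>M M \<rightarrow>\<^sub>M borel \<Otimes>\<^sub>M borel \<Otimes>\<^sub>M M"
    by measurable
  have "(\<lambda>(h, g, t). act g h t) \<in> borel \<Otimes>\<^sub>M borel \<Otimes>\<^sub>M M \<rightarrow>\<^sub>M M"
    using measurable_compose[OF swap act] by (simp add: split_beta')
  moreover have "(\<forall>t\<in>space M. act 0 0 t = t) \<and>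
      (\<forall>g1 g2 h1 h2. \<forall>t\<in>space M. act (g1 + g2) (h1 + h2) t = act g1 h1 (act g2 h2 t)) \<and>
      (\<forall>g h. distr M M (act g h) = M)"
    using assms unfolding mp_action_def by blast
  ultimately show ?thesis
    unfolding mp_action_def by blast
qed

theorem mainTheorem6:
  fixes lamG :: "'g::{group_add,t2_space,second_countable_topology} measure"
    and lamH :: "'h::{group_add,t2_space,second_countable_topology} measure"
    and act :: "'g \<Rightarrow> 'h \<Rightarrow> 'w \<Rightarrow> 'w"
    and \<eta> :: "'w measure" and \<mu> :: "'x measure" and \<nu> :: "'y measure"
    and i :: "'g \<times> 'y \<Rightarrow> 'w" and j :: "'h \<times> 'x \<Rightarrow> 'w"
  assumes "lcsc_group TYPE('g)" and "lcsc_group TYPE('h)"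
    and "unimodular_haar lamG" and "unimodular_haar lamH"
    and "me_coupling lamG lamH act \<eta> \<mu> \<nu> i j"
  shows "\<exists>\<Omega>' X' Y' (act' :: 'g \<Rightarrow> 'h \<Rightarrow> 'w \<Rightarrow> 'w).
     \<Omega>' \<in> sets \<eta> \<and> emeasure \<eta> (space \<eta> - \<Omega>') = 0 \<and>
     X' \<in> sets \<mu> \<and> emeasure \<mu> (space \<mu> - X') = 0 \<and>
     Y' \<in> sets \<nu> \<and> emeasure \<nu> (space \<nu> - Y') = 0 \<and>
     mp_action act' borel borel (restrict_space \<eta> \<Omega>') \<and>
     (\<forall>g h. AE t in \<eta>. t \<in> \<Omega>' \<longrightarrow> act g h t = act' g h t) \<and>
     (\<exists>i'. borel_iso (lamG \<Otimes>\<^sub>M restrict_space \<nu> Y') (restrict_space \<eta> \<Omega>') i' \<and>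
        distr (lamG \<Otimes>\<^sub>M restrict_space \<nu> Y') (restrict_space \<eta> \<Omega>') i' = restrict_space \<eta> \<Omega>' \<and>
        (\<forall>g0 g y. y \<in> Y' \<longrightarrow> i' (g0 + g, y) = act' g0 0 (i' (g, y)))) \<and>
     (\<exists>j'. borel_iso (lamH \<Otimes>\<^sub>M restrict_space \<mu> X') (restrict_space \<eta> \<Omega>') j' \<and>
        distr (lamH \<Otimes>\<^sub>M restrict_space \<mu> X') (restrict_space \<eta> \<Omega>') j' = restrict_space \<eta> \<Omega>' \<and>
        (\<forall>h0 h x. x \<in> X' \<longrightarrow> j' (h0 + h, x) = act' 0 h0 (j' (h, x))))"
proof -
  note groups = assms(1-4)
  from assms(5) have mp: "mp_action act borel borel \<eta>"
    and \<eta>: "standard_borel \<eta>" "emeasure \<eta> (space \<eta>) \<noteq> 0"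
    and \<mu>: "standard_borel \<mu>" "finite_measure \<mu>" and \<nu>: "standard_borel \<nu>" "finite_measure \<nu>"
    and i: "iso_measure_G_spaces (\<lambda>g (g', y). (g + g', y)) (lamG \<Otimes>\<^sub>M \<nu>) (\<lambda>g t. act g 0 t) \<eta> i"
    and j: "iso_measure_G_spaces (\<lambda>h (h', x). (h + h', x)) (lamH \<Otimes>\<^sub>M \<mu>) (\<lambda>h t. act 0 h t) \<eta> j"
    unfolding me_coupling_def by blast+
  obtain pG qG YG BG where "fundamental_domain act \<eta> lamG lamH \<nu> i pG qG YG BG"
    by (rule fundamental_domain_exists[OF groups mp \<eta> \<nu> i])
  then interpret G: fundamental_domain act \<eta> lamG lamH \<nu> i pG qG YG BG .
  obtain pH qH YH BH where "fundamental_domain (\<lambda>h g. act g h) \<eta> lamH lamG \<mu> j pH qH YH BH"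
    by (rule fundamental_domain_exists[OF groups(2,1,4,3) mp_action_swap[OF mp] \<eta> \<mu> j])
  then interpret H: fundamental_domain "\<lambda>h g. act g h" \<eta> lamH lamG \<mu> j pH qH YH BH .
  \<comment> \<open>Invariance treats the two groups alike, so a set found from the H side can be
    intersected with one found from the G side.\<close>
  have swap: "H.invariant W \<longleftrightarrow> G.invariant W" for W
    unfolding G.invariant_def H.invariant_def by auto
  obtain V where V: "G.invariant V" "\<And>W. G.invariant W \<Longrightarrow> W \<subseteq> V \<Longrightarrow> G.trivialized W"
    by (rule G.exists_trivialized[OF that])
  obtain V' where V': "H.invariant V'" "\<And>W. H.invariant W \<Longrightarrow> W \<subseteq> V' \<Longrightarrow> H.trivialized W"
    by (rule H.exists_trivialized[OF that])
  define W where "W = V \<inter> V'"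
  have W: "G.invariant W"
    unfolding W_def using V(1) V'(1) swap by (intro G.invariant_Int) auto
  obtain Y' i' where Y': "Y' \<in> sets \<nu>" "emeasure \<nu> (space \<nu> - Y') = 0"
    and i': "borel_iso (lamG \<Otimes>\<^sub>M restrict_space \<nu> Y') (restrict_space \<eta> W) i'"
      "distr (lamG \<Otimes>\<^sub>M restrict_space \<nu> Y') (restrict_space \<eta> W) i' = restrict_space \<eta> W"
      "\<forall>g0 g y. y \<in> Y' \<longrightarrow> i' (g0 + g, y) = act g0 0 (i' (g, y))"
    using V(2)[OF W] unfolding G.trivialized_def by (auto simp: W_def)
  obtain X' j' where X': "X' \<in> sets \<mu>" "emeasure \<mu> (space \<mu> - X') = 0"
    and j': "borel_iso (lamH \<Otimes>\<^sub>M restrict_space \<mu> X') (restrict_space \<eta> W) j'"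
      "distr (lamH \<Otimes>\<^sub>M restrict_space \<mu> X') (restrict_space \<eta> W) j' = restrict_space \<eta> W"
      "\<forall>h0 h x. x \<in> X' \<longrightarrow> j' (h0 + h, x) = act 0 h0 (j' (h, x))"
    using V'(2)[of W] W unfolding H.trivialized_def swap by (auto simp: W_def)
  show ?thesis
    using G.invariantD(1,3)[OF W] G.mp_action_restrict[OF W] X' Y' i' j'
    by (intro exI[of _ W] exI[of _ X'] exI[of _ Y'] exI[of _ act]) blast
qed

end
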